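(* Let $n\geq 2$ and let $A$ and $B$ be disjoint, nonempty subsets of $A_n$. The primary linear inequality $$\sum_{a\in A}x_a-\sum_{b\in B}x_b\leq 1$$ defines a facet of the semiorder polytope $\mathrm{P}_{\mathrm{SO}}^{n}$ if and only if (i) it is not exceptional; (ii) $A,B$ satisfy Conditions C1, C2, C4 and C5; (iii) for any $c$ in $B$, replacing $B$ with $B\setminus\{c\}$ makes at least one of the Conditions C1, C2, C4 and C5 become false.
   Context: $[n]=\{1,\dots,n\}$ and $A_n=\{(i,j) : i,j\in[n],\ i\neq j\}$. We write $x_{ij}$ for the coordinate $x_{(i,j)}$ of $x\in\mathbb{R}^{A_n}$. A semiorder on $[n]$ is a relation $S\subseteq A_n$ for which there exists $f:[n]\to\mathbb{R}$ such that $(i,j)\in S$ if and only if $f(i)+1<f(j)$. The characteristic vector $\chi^S\in\mathbb{R}^{A_n}$ has $\chi^S_{ij}=1$ if $(i,j)\in S$ and $0$ otherwise. The semiorder polytope is $\mathrm{P}_{\mathrm{SO}}^{n}=\operatorname{conv}\{\chi^S : S\text{ a semiorder on }[n]\}\subseteq\mathbb{R}^{A_n}$; it has full dimension $n(n-1)$. A linear inequality is valid for a polytope $P$ if all points of $P$ satisfy it; it defines a facet if it is valid and the set of points of $P$ satisfying it with equality is a face of dimension $\dim(P)-1$. A linear inequality is primary when its coefficients, including the independent term, take only the values $-1,0,1$. Conditions on $A,B\subseteq A_n$: C1: for any distinct pairs $(i,j),(k,l)\in A$, there holds $i\neq k$ and $j\neq l$. C2: for any $(i,j),(k,l)\in A$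 with $i,j,k,l$ distinct, there holds $(i,l)\in B$. C4: for any $(i,j),(j,k)\in A$ with $i,j,k$ distinct, either $(i,k)\in B$ or there exists some $p\in[n]\setminus\{i,j,k\}$ such that $(i,p),(p,k)\in B$. C5: for any $(i,j),(j,k),(k,l)\in A$ with $i,j,k,l$ distinct, at least one of the following holds: (v1) $(i,k)\in B$; (v2) $(j,l)\in B$; (v3) there is $r\in[n]\setminus\{i,j,k,l\}$ with $(i,r),(r,k)\in B$; (v4) there is $s\in[n]\setminus\{i,j,k,l\}$ with $(j,s),(s,l)\in B$; (v5) there is $t\in[n]\setminus\{i,j,k,l\}$ with $(i,t),(t,l)\in B$; (v6) there are $u,v\in[n]\setminus\{i,j,k,l\}$ with $(i,u),(u,v),(v,l)\in B$. Exceptional inequalities: assume $n\geq 6$ and let $A_6^{*}=\{(1,2),(2,3),(3,4),(4,1)\}$ and $B_6^{*}=\{(2,1),(3,2),(4,3),(1,4),(5,1),(5,2),(5,3),(5,4),(6,5),(1,6),(2,6),(3,6),(4,6)\}$. The pair $A,B$ (and the inequality $\sum_{a\in A}x_a-\sum_{b\in B}x_b\leq 1$) is exceptional when, possibly after a relabelling (permutation) of the elements of $[n]$, $A=A_6^{*}$ and $B=B_6^{*}$. (For $n<6$ nothing is exceptional.) *)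

theory Defs
  imports "HOL-Analysis.Analysis" "HOL-Library.Cardinality"
begin

text \<open>
  The ground set \<open>[n]\<close> is an arbitrary type \<open>'n\<close> of class \<^class>\<open>card2\<close> (finite, with at
  least two elements); \<open>n\<close> is \<open>CARD('n)\<close>. Relations on the ground set, and the sets \<open>A\<close> and \<open>B\<close>
  of pairs, have type \<open>('n \<times> 'n) set\<close> and are constrained to be subsets of \<open>arcs\<close>.
\<close>

definition arcs :: "('n \<times> 'n) set" where
  "arcs = {(i, j). i \<noteq> j}"

text \<open>
  \<open>'n arc\<close> is the set of arcs as a type, so that \<open>real ^ 'n arc\<close> is the space of real vectors
  with one coordinate for each ordered pair of distinct elements. The sort \<^class>\<open>card2\<close> is what
  makes this type nonempty.
\<close>

typedef ('n::card2) arc = "arcs :: ('n \<times> 'n) set"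
  morphisms ends Arc
proof -
  obtain i j :: 'n where "i \<noteq> j"
  proof (rule ccontr)
    assume "\<not> thesis"
    then have "(UNIV :: 'n set) \<subseteq> {undefined}"
      using that by blast
    then have "CARD('n) \<le> 1"
      using card_mono[of "{undefined :: 'n}" UNIV] by simp
    then show False
      using one_less_card[where 'a = 'n] by simp
  qed
  then show ?thesis
    unfolding arcs_def by blast
qed

instance arc :: (card2) finite
proof
  have "inj_on (ends :: 'a arc \<Rightarrow> 'a \<times> 'a) UNIV"
    by (simp add: inj_on_def ends_inject)
  then show "finite (UNIV :: 'a arc set)"
    using finite_imageD finite by blast
qed

text \<open>\<open>coord x (i, j)\<close> is the coordinate \<open>x\<^sub>i\<^sub>j\<close>; it is meaningful only for \<open>i \<noteq> j\<close>.\<close>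

definition coord :: "real ^ ('n::card2) arc \<Rightarrow> 'n \<times> 'n \<Rightarrow> real" where
  "coord x a = x $ Arc a"

definition semiorder :: "('n \<times> 'n) set \<Rightarrow> bool" where
  "semiorder S \<longleftrightarrow> S \<subseteq> arcs \<and>
     (\<exists>f :: 'n \<Rightarrow> real. \<forall>i j. (i, j) \<in> S \<longleftrightarrow> f i + 1 < f j)"

definition char_vec :: "('n \<times> 'n) set \<Rightarrow> real ^ ('n::card2) arc" where
  "char_vec S = (\<chi> a. if ends a \<in> S then 1 else 0)"

definition semiorder_polytope :: "(real ^ ('n::card2) arc) set" where
  "semiorder_polytope = convex hull {char_vec S | S. semiorder S}"

text \<open>
  The inequality \<open>l x \<le> d\<close>, where \<open>l\<close> is meant to be linear, defines a facet of \<open>P\<close>.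
  The additional requirement of \<^const>\<open>facet_of\<close> that the face be nonempty is automatic
  when \<open>aff_dim P > 0\<close>.
\<close>

definition defines_facet :: "('v::euclidean_space \<Rightarrow> real) \<Rightarrow> real \<Rightarrow> 'v set \<Rightarrow> bool" where
  "defines_facet l d P \<longleftrightarrow> (\<forall>x\<in>P. l x \<le> d) \<and> {x \<in> P. l x = d} facet_of P"

definition condC1 :: "('n \<times> 'n) set \<Rightarrow> bool" where
  "condC1 A \<longleftrightarrow> (\<forall>i j k l. (i, j) \<in> A \<and> (k, l) \<in> A \<and> (i, j) \<noteq> (k, l) \<longrightarrow> i \<noteq> k \<and> j \<noteq> l)"

definition condC2 :: "('n \<times> 'n) set \<Rightarrow> ('n \<times> 'n) set \<Rightarrow> bool" where
  "condC2 A B \<longleftrightarrow>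
     (\<forall>i j k l. (i, j) \<in> A \<and> (k, l) \<in> A \<and> distinct [i, j, k, l] \<longrightarrow> (i, l) \<in> B)"

definition condC4 :: "('n \<times> 'n) set \<Rightarrow> ('n \<times> 'n) set \<Rightarrow> bool" where
  "condC4 A B \<longleftrightarrow>
     (\<forall>i j k. (i, j) \<in> A \<and> (j, k) \<in> A \<and> distinct [i, j, k] \<longrightarrow>
        (i, k) \<in> B \<or> (\<exists>p. p \<notin> {i, j, k} \<and> (i, p) \<in> B \<and> (p, k) \<in> B))"

definition condC5 :: "('n \<times> 'n) set \<Rightarrow> ('n \<times> 'n) set \<Rightarrow> bool" where
  "condC5 A B \<longleftrightarrow>
     (\<forall>i j k l. (i, j) \<in> A \<and> (j, k) \<in> A \<and> (k, l) \<in> A \<and> distinct [i, j, k, l] \<longrightarrow>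
        (i, k) \<in> B \<or>
        (j, l) \<in> B \<or>
        (\<exists>r. r \<notin> {i, j, k, l} \<and> (i, r) \<in> B \<and> (r, k) \<in> B) \<or>
        (\<exists>s. s \<notin> {i, j, k, l} \<and> (j, s) \<in> B \<and> (s, l) \<in> B) \<or>
        (\<exists>t. t \<notin> {i, j, k, l} \<and> (i, t) \<in> B \<and> (t, l) \<in> B) \<or>
        (\<exists>u v. u \<notin> {i, j, k, l} \<and> v \<notin> {i, j, k, l} \<and>
           (i, u) \<in> B \<and> (u, v) \<in> B \<and> (v, l) \<in> B))"

definition all_conds :: "('n \<times> 'n) set \<Rightarrow> ('n \<times> 'n) set \<Rightarrow> bool" where
  "all_conds A B \<longleftrightarrow> condC1 A \<and> condC2 A B \<and> condC4 A B \<and> condC5 A B"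

definition A6 :: "(nat \<times> nat) set" where
  "A6 = {(1,2), (2,3), (3,4), (4,1)}"

definition B6 :: "(nat \<times> nat) set" where
  "B6 = {(2,1), (3,2), (4,3), (1,4), (5,1), (5,2), (5,3), (5,4), (6,5),
         (1,6), (2,6), (3,6), (4,6)}"

text \<open>
  Since the ground set is an abstract type, a relabelling is a bijection onto it from
  \<open>{1..CARD('n)}\<close>.
\<close>

definition exceptional :: "('n \<times> 'n) set \<Rightarrow> ('n \<times> 'n) set \<Rightarrow> bool" where
  "exceptional A B \<longleftrightarrow> 6 \<le> CARD('n) \<and>
     (\<exists>\<sigma> :: nat \<Rightarrow> 'n. bij_betw \<sigma> {1..CARD('n)} UNIV \<and>
        A = map_prod \<sigma> \<sigma> ` A6 \<and> B = map_prod \<sigma> \<sigma> ` B6)"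

end

theory Submission
  imports Defs
begin

text \<open>
On the vertex of a semiorder \<open>S\<close> the left-hand side is \<open>card (S \<inter> A) - card (S \<inter> B)\<close>. Everything is
therefore counted on semiorders, and \<open>S\<close> is called tight when \<open>card (S \<inter> A) = card (S \<inter> B) + 1\<close>.
An element is called a tail (head) when it is the tail (head) of an arc of \<open>A\<close>.

Validity is equivalent to C1, C2, C4 and C5 together. If one of them fails for some arcs of \<open>A\<close>, there
is a semiorder containing these arcs and too few arcs of \<open>B\<close> (\<open>all_conds_if_valid\<close>). Conversely, let
\<open>f\<close> represent \<open>S\<close> and let \<open>(i, j)\<close> be the arc of \<open>S \<inter> A\<close> whose tail is lowest. By C2, the arcs from
\<open>i\<close> to the heads of the other arcs of \<open>S \<inter> A\<close> lie in \<open>S \<inter> B\<close>, except for at most one arc \<open>(j, k)\<close>; if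
this exception occurs, C2, C4 or C5 supplies one more arc of \<open>S \<inter> B\<close> (\<open>valid_if_all_conds\<close>).

If \<open>all_conds A (B - {c})\<close> holds for some \<open>c\<in>B\<close>, then the left-hand side plus \<open>x\<^sub>c\<close> is still at most 1
on the polytope, so that the face lies in the hyperplane \<open>x\<^sub>c = 0\<close>. Its affine hull misses the origin and
is a proper part of that hyperplane, so the face is no facet (\<open>not_facet_if_lifted\<close>). For an
exceptional pair the coordinate of the arc \<open>(5, 6)\<close> can be added to the left-hand side in the same way
(\<open>exceptional_lifted\<close>).

For the converse let \<open>B\<close> be irredundant and let \<open>c\<close> be a linear functional that vanishes on all tight
semiorders. It has to be zero, since the vectors of the face then span the space and the face has
codimension 1 (\<open>facet_if_no_normal\<close>). A tight semiorder with a single arc \<open>e\<close> at which \<open>c\<close> is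
not yet known to vanish gives \<open>c e = 0\<close>. Small semiorders settle the arcs of \<open>A\<close>, and the arcs outside
\<open>B\<close> that start at a tail or end at a head. If \<open>b\<in>B\<close>, one of the conditions fails for \<open>B - {b}\<close>, and the
semiorder that violates the inequality of \<open>B - {b}\<close> is tight for \<open>B\<close> and contains \<open>b\<close>; this
settles \<open>b\<close> once all arcs outside \<open>A \<union> B\<close> are settled (\<open>zero_B\<close>).

What remains is an arc \<open>(p, q)\<close> outside \<open>A \<union> B\<close> with \<open>p\<close> no tail and \<open>q\<close> no head. An arc \<open>(i, j)\<in>A\<close> that
avoids \<open>p\<close> and \<open>q\<close> settles it unless \<open>(i, q)\<close> and \<open>(p, j)\<close> are both in \<open>B\<close>. If no arc settles it, all
these arcs of \<open>B\<close> must be indispensable for C4 or C5, so every such \<open>(i, j)\<close> has a predecessor and a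
successor in \<open>A\<close>. On a triangle, and on a path or cycle with five or more elements, not all of them can
be indispensable at once. Only three shapes of \<open>A\<close> survive: a 4-cycle, which is the exceptional pair, a
path \<open>q, i, j, p\<close>, and two arcs \<open>(q, j)\<close> and \<open>(i, p)\<close>. The last two are settled by one semiorder each.
\<close>

section \<open>Semiorders that violate the inequality when a condition fails\<close>

definition valid_for_semiorders :: "('n::finite \<times> 'n) set \<Rightarrow> ('n \<times> 'n) set \<Rightarrow> bool" where
  "valid_for_semiorders A B \<longleftrightarrow> (\<forall>S. semiorder S \<longrightarrow> card (S \<inter> A) \<le> card (S \<inter> B) + 1)"

definition threshold_rel :: "('n \<Rightarrow> real) \<Rightarrow> ('n \<times> 'n) set" where
  "threshold_rel f = {(i, j). f i + 1 < f j}"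

lemma semiorder_threshold_rel: "semiorder (threshold_rel f)"
  by (auto simp: semiorder_def threshold_rel_def arcs_def)

lemma semiorderE:
  assumes "semiorder S"
  obtains f where "S = threshold_rel f"
  using assms by (force simp: semiorder_def threshold_rel_def)

lemma semiorderI:
  fixes f :: "'n \<Rightarrow> real"
  assumes "\<And>x y. (x, y) \<in> S \<longleftrightarrow> f x + 1 < f y"
  shows "semiorder S"
proof -
  have "S = threshold_rel f" using assms by (auto simp: threshold_rel_def)
  then show ?thesis by (simp add: semiorder_threshold_rel)
qed

lemma semiorder_empty: "semiorder {}"
  by (rule semiorderI[of _ "\<lambda>_. 0"]) simp

lemma semiorder_common_tail:
  assumes "i \<noteq> j" "i \<noteq> q"
  shows "semiorder {(i, j), (i, q)}"
  by (rule semiorderI[of _ "\<lambda>x. if x = i then 0 else if x = j \<or> x = q then 3/2 else 1"])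
     (use assms in auto)

lemma semiorder_singleton: "i \<noteq> j \<Longrightarrow> semiorder {(i, j)}"
  using semiorder_common_tail[of i j j] by simp

lemma semiorder_common_head:
  assumes "i \<noteq> j" "p \<noteq> j"
  shows "semiorder {(i, j), (p, j)}"
  by (rule semiorderI[of _ "\<lambda>x. if x = j then 3/2 else if x = i \<or> x = p then 0 else 1"])
     (use assms in auto)

lemma semiorder_two_arcs:
  assumes "distinct [i, j, k, l]"
  shows "semiorder {(i, j), (k, l), (i, l)}"
proof -
  \<comment> \<open>The value of \<open>j\<close> exceeds that of \<open>i\<close> by more than 1, but not that of \<open>k\<close>; the value of \<open>l\<close> exceeds both.\<close>
  let ?f = "\<lambda>x. if x = i then 0 else if x = k then 1/2 else if x = j then 5/4
    else if x = l then 2 else (1::real)"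
  show ?thesis
  proof (rule semiorderI[of _ ?f])
    fix x y
    have ne: "i \<noteq> j" "i \<noteq> k" "i \<noteq> l" "j \<noteq> k" "j \<noteq> l" "k \<noteq> l"
      "j \<noteq> i" "k \<noteq> i" "l \<noteq> i" "k \<noteq> j" "l \<noteq> j" "l \<noteq> k" using assms by auto
    have x: "x = i \<or> x = j \<or> x = k \<or> x = l \<or> x \<notin> {i, j, k, l}" by blast
    have y: "y = i \<or> y = j \<or> y = k \<or> y = l \<or> y \<notin> {i, j, k, l}" by blast
    from x y show "(x, y) \<in> {(i, j), (k, l), (i, l)} \<longleftrightarrow> ?f x + 1 < ?f y"
      by (elim disjE) (simp_all add: ne)
  qed
qed

text \<open>
Along the chain \<open>i, j, k\<close> every further element has to be above \<open>i\<close> or below \<open>k\<close>; it can be chosen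
freely which of the two holds, and \<open>D\<close> collects the elements above \<open>i\<close>.
\<close>

lemma semiorder_chain3:
  assumes "distinct [i, j, k]"
  obtains S where "semiorder S" "(i, j) \<in> S" "(j, k) \<in> S"
    and "\<And>x y. (x, y) \<in> S \<Longrightarrow> (x, y) \<in> {(i, j), (j, k), (i, k)} \<or>
       x = i \<and> y \<in> D - {i, j, k} \<or> y = k \<and> x \<notin> D \<union> {i, j, k}"
proof -
  let ?f = "\<lambda>x. if x = i then 0 else if x = j then 11/10 else if x = k then 22/10
    else if x \<in> D then 12/10 else (1::real)"
  show thesis
  proof (rule that[of "threshold_rel ?f"])
    show "semiorder (threshold_rel ?f)" by (rule semiorder_threshold_rel)
    show "(i, j) \<in> threshold_rel ?f" "(j, k) \<in> threshold_rel ?f"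
      using assms by (auto simp: threshold_rel_def)
    fix x y assume "(x, y) \<in> threshold_rel ?f"
    then show "(x, y) \<in> {(i, j), (j, k), (i, k)} \<or>
       x = i \<and> y \<in> D - {i, j, k} \<or> y = k \<and> x \<notin> D \<union> {i, j, k}"
      using assms by (auto simp: threshold_rel_def split: if_splits)
  qed
qed

text \<open>
A further element has three cheapest positions relative to a chain \<open>i, j, k, l\<close>: just low enough not to
be above \<open>i\<close> (\<open>X\<close>), just high enough not to be below \<open>l\<close> (\<open>Z\<close>), or midway, where it is related
to \<open>i\<close> and \<open>l\<close> only. The arcs between further elements then all lead from \<open>X\<close> to \<open>Z\<close>.
\<close>

lemma semiorder_chain4:
  assumes "distinct [i, j, k, l]" and "X \<inter> Z = {}"
  obtains S where "semiorder S" "(i, j) \<in> S" "(j, k) \<in> S" "(k, l) \<in> S"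
    and "\<And>x y. (x, y) \<in> S \<Longrightarrow> (x, y) \<in> {(i, j), (j, k), (k, l), (i, k), (j, l), (i, l)} \<or>
       x \<in> X - {i, j, k, l} \<and> y \<in> {k, l} \<or>
       y \<in> Z - {i, j, k, l} \<and> x \<in> {i, j} \<or>
       x \<in> X - {i, j, k, l} \<and> y \<in> Z - {i, j, k, l} \<or>
       y \<notin> X \<union> Z \<union> {i, j, k, l} \<and> x = i \<or>
       x \<notin> X \<union> Z \<union> {i, j, k, l} \<and> y = l"
proof -
  let ?f = "\<lambda>x. if x = i then 0 else if x = j then 11/10 else if x = k then 22/10
    else if x = l then 33/10
    else if x \<in> X then 1 else if x \<in> Z then 23/10 else (165/100::real)"
  show thesis
  proof (rule that[of "threshold_rel ?f"])
    show "semiorder (threshold_rel ?f)" by (rule semiorder_threshold_rel)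
    show "(i, j) \<in> threshold_rel ?f" "(j, k) \<in> threshold_rel ?f" "(k, l) \<in> threshold_rel ?f"
      using assms by (auto simp: threshold_rel_def)
    fix x y assume "(x, y) \<in> threshold_rel ?f"
    then have less: "?f x + 1 < ?f y" by (simp add: threshold_rel_def)
    have y: "y = i \<or> y = j \<or> y = k \<or> y = l \<or> y \<in> X - {i, j, k, l} \<or> y \<in> Z - {i, j, k, l} \<or>
      y \<notin> X \<union> Z \<union> {i, j, k, l}" by blast
    have x: "x = i \<or> x = j \<or> x = k \<or> x = l \<or> x \<in> X - {i, j, k, l} \<or> x \<in> Z - {i, j, k, l} \<or>
      x \<notin> X \<union> Z \<union> {i, j, k, l}" by blast
    have XZ: "z \<in> Z \<Longrightarrow> z \<notin> X" for z using assms(2) by blast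
    have ne: "i \<noteq> j" "i \<noteq> k" "i \<noteq> l" "j \<noteq> k" "j \<noteq> l" "k \<noteq> l"
      "j \<noteq> i" "k \<noteq> i" "l \<noteq> i" "k \<noteq> j" "l \<noteq> j" "l \<noteq> k" using assms(1) by auto
    show "(x, y) \<in> {(i, j), (j, k), (k, l), (i, k), (j, l), (i, l)} \<or>
       x \<in> X - {i, j, k, l} \<and> y \<in> {k, l} \<or>
       y \<in> Z - {i, j, k, l} \<and> x \<in> {i, j} \<or>
       x \<in> X - {i, j, k, l} \<and> y \<in> Z - {i, j, k, l} \<or>
       y \<notin> X \<union> Z \<union> {i, j, k, l} \<and> x = i \<or>
       x \<notin> X \<union> Z \<union> {i, j, k, l} \<and> y = l"
      using x y less by (elim disjE) (simp_all add: ne XZ)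
  qed
qed

text \<open>
C4 and C5 for one path of \<open>A\<close>. Naming them separately makes it possible to say on which path a condition
breaks when an arc is removed from \<open>B\<close>.
\<close>

definition C4_at :: "('n \<times> 'n) set \<Rightarrow> 'n \<Rightarrow> 'n \<Rightarrow> 'n \<Rightarrow> bool" where
  "C4_at B i j k \<longleftrightarrow>
     (i, k) \<in> B \<or> (\<exists>p. p \<notin> {i, j, k} \<and> (i, p) \<in> B \<and> (p, k) \<in> B)"

definition C5_at :: "('n \<times> 'n) set \<Rightarrow> 'n \<Rightarrow> 'n \<Rightarrow> 'n \<Rightarrow> 'n \<Rightarrow> bool" where
  "C5_at B i j k l \<longleftrightarrow>
        (i, k) \<in> B \<or>
        (j, l) \<in> B \<or>
        (\<exists>r. r \<notin> {i, j, k, l} \<and> (i, r) \<in> B \<and> (r, k) \<in> B) \<or>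
        (\<exists>s. s \<notin> {i, j, k, l} \<and> (j, s) \<in> B \<and> (s, l) \<in> B) \<or>
        (\<exists>t. t \<notin> {i, j, k, l} \<and> (i, t) \<in> B \<and> (t, l) \<in> B) \<or>
        (\<exists>u v. u \<notin> {i, j, k, l} \<and> v \<notin> {i, j, k, l} \<and>
           (i, u) \<in> B \<and> (u, v) \<in> B \<and> (v, l) \<in> B)"

lemma condC4_iff: "condC4 A B \<longleftrightarrow>
    (\<forall>i j k. (i, j) \<in> A \<and> (j, k) \<in> A \<and> distinct [i, j, k] \<longrightarrow> C4_at B i j k)"
  by (simp add: condC4_def C4_at_def)

lemma condC5_iff: "condC5 A B \<longleftrightarrow>
    (\<forall>i j k l. (i, j) \<in> A \<and> (j, k) \<in> A \<and> (k, l) \<in> A \<and> distinct [i, j, k, l]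
       \<longrightarrow> C5_at B i j k l)"
  by (simp add: condC5_def C5_at_def)

text \<open>
Each further element \<open>l\<close> is put above \<open>i\<close> if \<open>(i, l) \<notin> B\<close> and below \<open>k\<close> otherwise; the failure of C4 says
that the second choice avoids \<open>B\<close> as well. The conclusion on the ends of the arcs of \<open>S\<close> makes it
possible to evaluate a functional on \<open>S\<close> later.
\<close>

lemma C4_violator:
  assumes "distinct [i, j, k]" and "(i, j) \<notin> B" "(j, k) \<notin> B" and "\<not> C4_at B i j k"
  shows "\<exists>S. semiorder S \<and> (i, j) \<in> S \<and> (j, k) \<in> S \<and> S \<inter> B = {} \<and>
    (\<forall>(x, y)\<in>S. x = i \<or> y = k)"
proof -
  show ?thesis
  proof (rule semiorder_chain3[OF assms(1)])
    fix S
    assume S: "semiorder S" "(i, j) \<in> S" "(j, k) \<in> S"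
    and mem: "\<And>x y. (x, y) \<in> S \<Longrightarrow> (x, y) \<in> {(i, j), (j, k), (i, k)} \<or>
       x = i \<and> y \<in> {l. (i, l) \<notin> B} - {i, j, k} \<or> y = k \<and> x \<notin> {l. (i, l) \<notin> B} \<union> {i, j, k}"
  have "(x, y) \<notin> B" if "(x, y) \<in> S" for x y
    using mem[OF that] assms(2-4) unfolding C4_at_def by auto
  then have "S \<inter> B = {}" by auto
  then show ?thesis using S mem by blast
  qed
qed

text \<open>
The elements \<open>r\<close> with \<open>(i, r)\<in>B\<close> go to the low position and those with \<open>(r, l)\<in>B\<close> to the high one. The
six alternatives of C5 are what could make these two demands collide or let the resulting semiorder
meet \<open>B\<close> outside \<open>(i, l)\<close>.
\<close>

lemma C5_violator:
  assumes "distinct [i, j, k, l]" and "(i, j) \<notin> B" "(j, k) \<notin> B" "(k, l) \<notin> B"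
    and "\<not> C5_at B i j k l"
  shows "\<exists>S. semiorder S \<and> (i, j) \<in> S \<and> (j, k) \<in> S \<and> (k, l) \<in> S \<and> S \<inter> B \<subseteq> {(i, l)}"
proof -
  define X Z where "X = {r. (i, r) \<in> B} - {i, j, k, l}" and "Z = {r. (r, l) \<in> B} - {i, j, k, l}"
  have v: "(i, k) \<notin> B" "(j, l) \<notin> B"
    "r \<notin> {i, j, k, l} \<Longrightarrow> (i, r) \<in> B \<Longrightarrow> (r, k) \<notin> B"
    "r \<notin> {i, j, k, l} \<Longrightarrow> (j, r) \<in> B \<Longrightarrow> (r, l) \<notin> B"
    "r \<notin> {i, j, k, l} \<Longrightarrow> (i, r) \<in> B \<Longrightarrow> (r, l) \<notin> B"
    "u \<notin> {i, j, k, l} \<Longrightarrow> r \<notin> {i, j, k, l} \<Longrightarrow> (i, u) \<in> B \<Longrightarrow> (u, r) \<in> B \<Longrightarrow> (r, l) \<notin> B"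
    for r u
    using assms(5) unfolding C5_at_def by metis+
  have XZ: "X \<inter> Z = {}" unfolding X_def Z_def using v(5) by auto
  show ?thesis
  proof (rule semiorder_chain4[OF assms(1) XZ])
    fix S
    assume S: "semiorder S" "(i, j) \<in> S" "(j, k) \<in> S" "(k, l) \<in> S"
    and mem: "\<And>x y. (x, y) \<in> S \<Longrightarrow> (x, y) \<in> {(i, j), (j, k), (k, l), (i, k), (j, l), (i, l)} \<or>
       x \<in> X - {i, j, k, l} \<and> y \<in> {k, l} \<or>
       y \<in> Z - {i, j, k, l} \<and> x \<in> {i, j} \<or>
       x \<in> X - {i, j, k, l} \<and> y \<in> Z - {i, j, k, l} \<or>
       y \<notin> X \<union> Z \<union> {i, j, k, l} \<and> x = i \<or>
       x \<notin> X \<union> Z \<union> {i, j, k, l} \<and> y = l"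
  have "(x, y) = (i, l)" if xy: "(x, y) \<in> S" and B: "(x, y) \<in> B" for x y
    using mem[OF xy] 
  proof (elim disjE)
    assume "(x, y) \<in> {(i, j), (j, k), (k, l), (i, k), (j, l), (i, l)}"
    then show ?thesis using assms B v by auto
  next
    assume "x \<in> X - {i, j, k, l} \<and> y \<in> {k, l}"
    then show ?thesis using v(3,5)[of x] B by (auto simp: X_def)
  next
    assume "y \<in> Z - {i, j, k, l} \<and> x \<in> {i, j}"
    then show ?thesis using v(4,5)[of y] B by (auto simp: Z_def)
  next
    assume "x \<in> X - {i, j, k, l} \<and> y \<in> Z - {i, j, k, l}"
    then show ?thesis using v(6)[of x y] B by (auto simp: X_def Z_def)
  qed (use B in \<open>auto simp: X_def Z_def\<close>)
  then have "S \<inter> B \<subseteq> {(i, l)}" by auto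
  then show ?thesis using S by blast
  qed
qed

lemma all_conds_if_valid:
  fixes A B :: "('n::finite \<times> 'n) set"
  assumes arcs: "A \<subseteq> arcs" and disj: "A \<inter> B = {}" and valid: "valid_for_semiorders A B"
  shows "all_conds A B"
proof -
  have hits: "S \<inter> B \<noteq> {}" if "semiorder S" "a \<in> S \<inter> A" "b \<in> S \<inter> A" "a \<noteq> b" for S a b
  proof
    assume "S \<inter> B = {}"
    then have "card (S \<inter> A) \<le> 1"
      using valid that(1) unfolding valid_for_semiorders_def by fastforce
    moreover have "card {a, b} \<le> card (S \<inter> A)"
      using that by (intro card_mono) auto
    ultimately show False using that by simp
  qed
  have irrefl: "(x, y) \<in> A \<Longrightarrow> x \<noteq> y" for x y using arcs by (auto simp: arcs_def)
  have C1: "condC1 A"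
    unfolding condC1_def
  proof (intro allI impI, elim conjE)
    fix i j k l assume a: "(i, j) \<in> A" "(k, l) \<in> A" "(i, j) \<noteq> (k, l)"
    have "i \<noteq> k"
    proof
      assume "i = k"
      then have "{(i, j), (i, l)} \<inter> B \<noteq> {}"
        using hits[of "{(i, j), (i, l)}" "(i, j)" "(i, l)"] semiorder_common_tail[of i j l] a irrefl
        by auto
      then show False using a disj \<open>i = k\<close> by auto
    qed
    moreover have "j \<noteq> l"
    proof
      assume "j = l"
      then have "{(i, j), (k, j)} \<inter> B \<noteq> {}"
        using hits[of "{(i, j), (k, j)}" "(i, j)" "(k, j)"] semiorder_common_head[of i j k] a irrefl
        by auto
      then show False using a disj \<open>j = l\<close> by auto
    qed
    ultimately show "i \<noteq> k \<and> j \<noteq> l" ..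
  qed
  have C2: "condC2 A B"
    unfolding condC2_def
  proof (intro allI impI, elim conjE)
    fix i j k l assume a: "(i, j) \<in> A" "(k, l) \<in> A" "distinct [i, j, k, l]"
    then have "{(i, j), (k, l), (i, l)} \<inter> B \<noteq> {}"
      using hits[OF semiorder_two_arcs[OF a(3)], of "(i, j)" "(k, l)"] by auto
    then show "(i, l) \<in> B" using a disj by auto
  qed
  have C4: "condC4 A B"
    unfolding condC4_iff
  proof (intro allI impI, elim conjE, rule ccontr)
    fix i j k assume a: "(i, j) \<in> A" "(j, k) \<in> A" "distinct [i, j, k]" "\<not> C4_at B i j k"
    then obtain S where "semiorder S" "(i, j) \<in> S" "(j, k) \<in> S" "S \<inter> B = {}"
      using C4_violator[OF a(3), of B] disj by blast
    then show False using hits[of S "(i, j)" "(j, k)"] a by auto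
  qed
  have C5: "condC5 A B"
    unfolding condC5_iff
  proof (intro allI impI, elim conjE, rule ccontr)
    fix i j k l assume a: "(i, j) \<in> A" "(j, k) \<in> A" "(k, l) \<in> A" "distinct [i, j, k, l]"
      "\<not> C5_at B i j k l"
    then obtain S where S: "semiorder S" "(i, j) \<in> S" "(j, k) \<in> S" "(k, l) \<in> S" "S \<inter> B \<subseteq> {(i, l)}"
      using C5_violator[OF a(4), of B] disj by blast
    have "card (S \<inter> B) \<le> card {(i, l)}" using S by (intro card_mono) auto
    moreover have "card {(i, j), (j, k), (k, l)} \<le> card (S \<inter> A)"
      using S a by (intro card_mono) auto
    moreover have "card (S \<inter> A) \<le> card (S \<inter> B) + 1"
      using valid S(1) by (simp add: valid_for_semiorders_def)
    ultimately show False using a(4) by simp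
  qed
  show ?thesis using C1 C2 C4 C5 by (simp add: all_conds_def)
qed

section \<open>The conditions imply validity\<close>

lemma condC1_tail_eq_iff_head_eq:
  assumes "condC1 A" "(i, j) \<in> A" "(k, l) \<in> A"
  shows "i = k \<longleftrightarrow> j = l"
  using assms unfolding condC1_def by blast

text \<open>
The arcs from the lowest tail \<open>i\<close> to the other heads form a set \<open>T\<close> of arcs of \<open>S \<inter> B\<close>. It misses the
required size by at most one, and only if \<open>S \<inter> A\<close> contains a path \<open>i, j, k\<close>. One arc of \<open>S \<inter> B\<close> outside
\<open>T\<close> is then obtained from C2 if \<open>S \<inter> A\<close> has an arc with tail outside the path, from C5 if the path
goes on to a fourth element, and from C4 otherwise.
\<close>

lemma valid_if_all_conds:
  fixes A B :: "('n::finite \<times> 'n) set"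
  assumes arcs: "A \<subseteq> arcs" and conds: "all_conds A B"
  shows "valid_for_semiorders A B"
  unfolding valid_for_semiorders_def
proof (intro allI impI)
  fix S :: "('n \<times> 'n) set" assume "semiorder S"
  then obtain f where "S = threshold_rel f" by (rule semiorderE)
  then have S: "(x, y) \<in> S \<longleftrightarrow> f x + 1 < f y" for x y
    by (simp add: threshold_rel_def)
  have C1: "condC1 A" and C2: "condC2 A B" and C4: "condC4 A B" and C5: "condC5 A B"
    using conds by (auto simp: all_conds_def)
  define M where "M = S \<inter> A"
  have fin: "finite M" "finite (S \<inter> B)" by simp_all
  have MA: "m \<in> M \<Longrightarrow> m \<in> A" for m by (simp add: M_def)
  have Mlt: "(x, y) \<in> M \<Longrightarrow> f x + 1 < f y" for x y by (simp add: M_def S)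
  have irrefl: "(x, y) \<in> M \<Longrightarrow> x \<noteq> y" for x y using Mlt by force
  have inj: "x = x' \<longleftrightarrow> y = y'" if "(x, y) \<in> M" "(x', y') \<in> M" for x y x' y'
    using condC1_tail_eq_iff_head_eq[OF C1 MA MA] that by blast
  have cross: "(x, y') \<in> B"
    if "(x, y) \<in> M" "(x', y') \<in> M" "x \<noteq> x'" "x \<noteq> y'" "x' \<noteq> y" for x y x' y'
  proof -
    have "distinct [x, y, x', y']"
      using that irrefl inj[OF that(1,2)] by auto
    then show ?thesis using C2 that(1,2)[THEN MA] unfolding condC2_def by blast
  qed
  show "card (S \<inter> A) \<le> card (S \<inter> B) + 1"
  proof (cases "M = {}")
    case True
    then show ?thesis by (simp add: M_def)
  next
    case False
    then obtain a where a: "is_arg_min (\<lambda>m. f (fst m)) (\<lambda>m. m \<in> M) a"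
      using ex_is_arg_min_if_finite[OF fin(1)] by blast
    obtain i j where a_eq: "a = (i, j)" by (cases a)
    have ij: "(i, j) \<in> M" and least: "(x, y) \<in> M \<Longrightarrow> f i \<le> f x" for x y
      using a unfolding is_arg_min_linorder a_eq by force+
    define M' where "M' = {m \<in> M. m \<noteq> (i, j) \<and> fst m \<noteq> j}"
    define T where "T = (\<lambda>m. (i, snd m)) ` M'"
    have "inj_on (\<lambda>m. (i, snd m)) M'"
      using inj by (auto simp: inj_on_def M'_def)
    then have card_T: "card T = card M'" unfolding T_def by (rule card_image)
    have T_E: "\<exists>x y. t = (i, y) \<and> (x, y) \<in> M \<and> (x, y) \<noteq> (i, j) \<and> x \<noteq> j" if "t \<in> T" for t
    proof -
      obtain m where "m \<in> M'" "t = (i, snd m)" using \<open>t \<in> T\<close> unfolding T_def by blast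
      then show ?thesis by (cases m) (force simp: M'_def)
    qed
    have T_sub: "T \<subseteq> S \<inter> B"
    proof
      fix t assume "t \<in> T"
      then obtain x y where t: "t = (i, y)" and xy: "(x, y) \<in> M" "(x, y) \<noteq> (i, j)" "x \<noteq> j"
        using T_E by blast
      have lt: "f i + 1 < f y" using Mlt[OF xy(1)] least[OF xy(1)] by simp
      then have "i \<noteq> y" by auto
      moreover have "i \<noteq> x" using inj[OF ij xy(1)] xy(2) by auto
      ultimately have "(i, y) \<in> B" using cross[OF ij xy(1)] xy(3) by blast
      then show "t \<in> S \<inter> B" using lt by (simp add: t S)
    qed
    have card_T_le: "card T \<le> card (S \<inter> B)" by (rule card_mono[OF fin(2) T_sub])
    show ?thesis
    proof (cases "\<exists>k. (j, k) \<in> M")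
      case False
      then have "M \<subseteq> insert (i, j) M'" by (auto simp: M'_def)
      then have "card M \<le> card M' + 1"
        using card_mono[of "insert (i, j) M'" M] card_insert_le_m1 card_insert_if[of M' "(i, j)"]
        by (auto split: if_splits)
      then show ?thesis using card_T card_T_le by (simp add: M_def)
    next
      case True
      then obtain k where jk: "(j, k) \<in> M" by blast
      have "f i < f j" "f j < f k" using Mlt[OF ij] Mlt[OF jk] by auto
      then have ijk: "distinct [i, j, k]" by auto
      have "M \<subseteq> insert (i, j) (insert (j, k) M')"
      proof
        fix m assume "m \<in> M"
        then show "m \<in> insert (i, j) (insert (j, k) M')"
          using inj[OF jk, of "fst m" "snd m"] by (cases m) (auto simp: M'_def)
      qed
      then have "card M \<le> card (insert (i, j) (insert (j, k) M'))"
        by (intro card_mono) auto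
      also have "\<dots> \<le> card M' + 2"
        by (simp add: card_insert_if)
      finally have card_M: "card M \<le> card M' + 2" .
      have "\<exists>b\<in>S \<inter> B. b \<notin> T"
      proof (cases "\<exists>x y. (x, y) \<in> M \<and> x \<notin> {i, j, k}")
        case True
        then obtain x y where xy: "(x, y) \<in> M" "x \<noteq> i" "x \<noteq> j" "x \<noteq> k" by blast
        have "y \<noteq> j" using inj[OF xy(1) ij] xy by auto
        then have "(x, k) \<in> B" "(j, y) \<in> B"
          using cross[OF xy(1) jk] cross[OF jk xy(1)] xy by auto
        moreover have "(x, k) \<in> S \<or> (j, y) \<in> S"
          using Mlt[OF xy(1)] Mlt[OF jk] by (auto simp: S)
        moreover have "(x, k) \<notin> T" "(j, y) \<notin> T" using xy ijk by (auto simp: T_def)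
        ultimately show ?thesis by blast
      next
        case False
        then have tails: "(x, y) \<in> M \<Longrightarrow> x \<in> {i, j, k}" for x y by blast
        show ?thesis
        proof (cases "\<exists>l. (k, l) \<in> M")
          case False
          have "T = {}"
            using T_E tails False inj[OF ij] by blast
          have "C4_at B i j k"
            using C4 ij jk ijk MA unfolding condC4_iff by blast
          then have "\<exists>b\<in>S. b \<in> B"
            unfolding C4_at_def
          proof (elim disjE exE conjE)
            assume "(i, k) \<in> B"
            then show ?thesis using Mlt[OF ij] Mlt[OF jk] S[of i k] by auto
          next
            fix p assume "(i, p) \<in> B" "(p, k) \<in> B"
            moreover have "(i, p) \<in> S \<or> (p, k) \<in> S"
              using Mlt[OF ij] Mlt[OF jk] by (auto simp: S)
            ultimately show ?thesis by blast
          qed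
          then show ?thesis using \<open>T = {}\<close> by blast
        next
          case True
          then obtain l where kl: "(k, l) \<in> M" by blast
          have lt: "f i + 1 < f j" "f j + 1 < f k" "f k + 1 < f l"
            using Mlt[OF ij] Mlt[OF jk] Mlt[OF kl] by auto
          then have ijkl: "distinct [i, j, k, l]" by auto
          have "t = (i, l)" if t: "t \<in> T" for t
          proof -
            obtain x y where "t = (i, y)" "(x, y) \<in> M" "(x, y) \<noteq> (i, j)" "x \<noteq> j"
              using T_E[OF t] by blast
            then show ?thesis using tails inj[OF ij, of x y] inj[OF kl, of x y] by auto
          qed
          then have T: "b \<notin> T" if "b \<noteq> (i, l)" for b using that by blast
          have "C5_at B i j k l"
            using C5 ij jk kl ijkl MA unfolding condC5_iff by blast
          then have "\<exists>b\<in>S \<inter> B. b \<noteq> (i, l)"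
            unfolding C5_at_def
          proof (elim disjE exE conjE)
            assume "(i, k) \<in> B"
            moreover have "(i, k) \<in> S" using lt by (auto simp: S)
            ultimately show ?thesis using ijkl by force
          next
            assume "(j, l) \<in> B"
            moreover have "(j, l) \<in> S" using lt by (auto simp: S)
            ultimately show ?thesis using ijkl by force
          next
            fix r assume r: "r \<notin> {i, j, k, l}" "(i, r) \<in> B" "(r, k) \<in> B"
            moreover have "(i, r) \<in> S \<or> (r, k) \<in> S" using lt by (auto simp: S)
            moreover have "(i, r) \<noteq> (i, l)" "(r, k) \<noteq> (i, l)" using r by auto
            ultimately show ?thesis by blast
          next
            fix s assume s: "s \<notin> {i, j, k, l}" "(j, s) \<in> B" "(s, l) \<in> B"
            moreover have "(j, s) \<in> S \<or> (s, l) \<in> S" using lt by (auto simp: S)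
            moreover have "(j, s) \<noteq> (i, l)" "(s, l) \<noteq> (i, l)" using s by auto
            ultimately show ?thesis by blast
          next
            fix t assume t: "t \<notin> {i, j, k, l}" "(i, t) \<in> B" "(t, l) \<in> B"
            moreover have "(i, t) \<in> S \<or> (t, l) \<in> S" using lt by (auto simp: S)
            moreover have "(i, t) \<noteq> (i, l)" "(t, l) \<noteq> (i, l)" using t by auto
            ultimately show ?thesis by blast
          next
            fix u v assume uv: "u \<notin> {i, j, k, l}" "v \<notin> {i, j, k, l}"
              "(i, u) \<in> B" "(u, v) \<in> B" "(v, l) \<in> B"
            moreover have "(i, u) \<in> S \<or> (u, v) \<in> S \<or> (v, l) \<in> S" using lt by (auto simp: S)
            moreover have "(i, u) \<noteq> (i, l)" "(u, v) \<noteq> (i, l)" "(v, l) \<noteq> (i, l)" using uv by auto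
            ultimately show ?thesis by blast
          qed
          then show ?thesis using T by blast
        qed
      qed
      then obtain b where b: "b \<in> S \<inter> B" "b \<notin> T" by blast
      have "card (insert b T) \<le> card (S \<inter> B)"
        using b T_sub by (intro card_mono) auto
      then have "card T + 1 \<le> card (S \<inter> B)"
        using b by (simp add: card_insert_if)
      then show ?thesis using card_M card_T by (simp add: M_def)
    qed
  qed
qed

section \<open>Irredundant pairs and the role of each arc of B\<close>

lemma C4_at_mono: "C4_at B i j k \<Longrightarrow> B \<subseteq> B' \<Longrightarrow> C4_at B' i j k"
  unfolding C4_at_def by blast

lemma C5_at_mono: "C5_at B i j k l \<Longrightarrow> B \<subseteq> B' \<Longrightarrow> C5_at B' i j k l"
  unfolding C5_at_def by (elim disjE exE conjE) (metis in_mono)+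

lemma all_conds_mono: "all_conds A B \<Longrightarrow> B \<subseteq> B' \<Longrightarrow> all_conds A B'"
  unfolding all_conds_def condC2_def condC4_iff condC5_iff
  by (meson C4_at_mono C5_at_mono in_mono)

lemma C4_at_detour: "p \<notin> {i, j, k} \<Longrightarrow> (i, p) \<in> B \<Longrightarrow> (p, k) \<in> B \<Longrightarrow> C4_at B i j k"
  unfolding C4_at_def by blast

lemma C5_at_detour_to_third: "r \<notin> {i, j, k, l} \<Longrightarrow> (i, r) \<in> B \<Longrightarrow> (r, k) \<in> B \<Longrightarrow> C5_at B i j k l"
  and C5_at_detour_to_fourth: "t \<notin> {i, j, k, l} \<Longrightarrow> (i, t) \<in> B \<Longrightarrow> (t, l) \<in> B \<Longrightarrow> C5_at B i j k l"
  and C5_at_two_step_detour: "u \<notin> {i, j, k, l} \<Longrightarrow> v \<notin> {i, j, k, l} \<Longrightarrow> (i, u) \<in> B \<Longrightarrow> (u, v) \<in> B \<Longrightarrow>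
    (v, l) \<in> B \<Longrightarrow> C5_at B i j k l"
  unfolding C5_at_def by metis+

lemma C4_at_converse: "C4_at (B\<inverse>) k j i \<longleftrightarrow> C4_at B i j k"
  unfolding C4_at_def by auto

lemma C5_at_converse: "C5_at (B\<inverse>) l k j i \<longleftrightarrow> C5_at B i j k l"
proof -
  have "C5_at B i j k l" if "C5_at (B\<inverse>) l k j i" for B :: "('a \<times> 'a) set" and i j k l
    using that unfolding C5_at_def converse_iff insert_iff empty_iff
    by (elim disjE exE conjE) metis+
  from this[of B] this[of "B\<inverse>"] show ?thesis by auto
qed

lemma all_conds_converse: "all_conds (A\<inverse>) (B\<inverse>) \<longleftrightarrow> all_conds A B"
proof -
  have *: "all_conds (A\<inverse>) (B\<inverse>)" if "all_conds A B" for A B :: "('a \<times> 'a) set"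
  proof -
    have "condC1 A" "condC2 A B" "condC4 A B" "condC5 A B" using that by (auto simp: all_conds_def)
    moreover have "condC1 (A\<inverse>)"
      using \<open>condC1 A\<close> unfolding condC1_def by blast
    moreover have "condC2 (A\<inverse>) (B\<inverse>)"
      using \<open>condC2 A B\<close> unfolding condC2_def by auto
    moreover have "condC4 (A\<inverse>) (B\<inverse>)"
      using \<open>condC4 A B\<close> unfolding condC4_iff C4_at_converse converse_iff by auto
    moreover have "condC5 (A\<inverse>) (B\<inverse>)"
      using \<open>condC5 A B\<close> unfolding condC5_iff C5_at_converse converse_iff by auto
    ultimately show ?thesis by (simp add: all_conds_def)
  qed
  from *[of A B] *[of "A\<inverse>" "B\<inverse>"] show ?thesis by auto
qed

text \<open>
If the removal of \<open>b\<close> breaks the condition on a path, then \<open>b\<close> lies on every detour that satisfies it;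
this and the next lemma retain one such detour.
\<close>

lemma C4_at_critical:
  assumes "C4_at B i j k" "\<not> C4_at (B - {b}) i j k"
  shows "b = (i, k) \<or> (\<exists>p. p \<notin> {i, j, k} \<and> (i, p) \<in> B \<and> (p, k) \<in> B \<and> b \<in> {(i, p), (p, k)})"
  using assms unfolding C4_at_def by auto

lemma C5_at_critical:
  assumes "C5_at B i j k l" "\<not> C5_at (B - {b}) i j k l"
  shows "b = (i, k) \<or> b = (j, l) \<or>
    (\<exists>r. r \<notin> {i, j, k, l} \<and> (i, r) \<in> B \<and> (r, k) \<in> B \<and> b \<in> {(i, r), (r, k)}) \<or>
    (\<exists>s. s \<notin> {i, j, k, l} \<and> (j, s) \<in> B \<and> (s, l) \<in> B \<and> b \<in> {(j, s), (s, l)}) \<or>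
    (\<exists>t. t \<notin> {i, j, k, l} \<and> (i, t) \<in> B \<and> (t, l) \<in> B \<and> b \<in> {(i, t), (t, l)}) \<or>
    (\<exists>u v. u \<notin> {i, j, k, l} \<and> v \<notin> {i, j, k, l} \<and> (i, u) \<in> B \<and> (u, v) \<in> B \<and> (v, l) \<in> B \<and>
       b \<in> {(i, u), (u, v), (v, l)})"
  using assms(1) unfolding C5_at_def
proof (elim disjE exE conjE)
  assume "(i, k) \<in> B"
  moreover have "(i, k) \<notin> B - {b}" using assms(2) unfolding C5_at_def by blast
  ultimately show ?thesis by blast
next
  assume "(j, l) \<in> B"
  moreover have "(j, l) \<notin> B - {b}" using assms(2) unfolding C5_at_def by blast
  ultimately show ?thesis by blast
next
  fix r assume *: "r \<notin> {i, j, k, l}" "(i, r) \<in> B" "(r, k) \<in> B"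
  then have "\<not> ((i, r) \<in> B - {b} \<and> (r, k) \<in> B - {b})"
    using assms(2) C5_at_detour_to_third by metis
  then have "b \<in> {(i, r), (r, k)}" using * by blast
  then show ?thesis using * by metis
next
  fix s assume *: "s \<notin> {i, j, k, l}" "(j, s) \<in> B" "(s, l) \<in> B"
  then have "\<not> ((j, s) \<in> B - {b} \<and> (s, l) \<in> B - {b})"
    using assms(2) unfolding C5_at_def by metis
  then have "b \<in> {(j, s), (s, l)}" using * by blast
  then show ?thesis using * by metis
next
  fix t assume *: "t \<notin> {i, j, k, l}" "(i, t) \<in> B" "(t, l) \<in> B"
  then have "\<not> ((i, t) \<in> B - {b} \<and> (t, l) \<in> B - {b})"
    using assms(2) C5_at_detour_to_fourth by metis
  then have "b \<in> {(i, t), (t, l)}" using * by blast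
  then show ?thesis using * by metis
next
  fix u v assume *: "u \<notin> {i, j, k, l}" "v \<notin> {i, j, k, l}" "(i, u) \<in> B" "(u, v) \<in> B" "(v, l) \<in> B"
  then have "\<not> ((i, u) \<in> B - {b} \<and> (u, v) \<in> B - {b} \<and> (v, l) \<in> B - {b})"
    using assms(2) C5_at_two_step_detour by metis
  then have "b \<in> {(i, u), (u, v), (v, l)}" using * by blast
  then show ?thesis using * by metis
qed

text \<open>
Every argument below comes with its mirror image, obtained by reversing all arcs. The locale is closed
under this reversal (lemma \<open>dual\<close>), so that only one of the two has to be carried out.
\<close>

locale irredundant_pair =
  fixes A B :: "('n::finite \<times> 'n) set"
  assumes A_arcs: "A \<subseteq> arcs" and B_arcs: "B \<subseteq> arcs" and disj: "A \<inter> B = {}"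
    and conds: "all_conds A B"
    and irredundant: "b \<in> B \<Longrightarrow> \<not> all_conds A (B - {b})"
begin

lemma dual: "irredundant_pair (A\<inverse>) (B\<inverse>)"
proof
  show "A\<inverse> \<subseteq> arcs" "B\<inverse> \<subseteq> arcs" using A_arcs B_arcs by (auto simp: arcs_def)
  show "A\<inverse> \<inter> B\<inverse> = {}" using disj by auto
  show "all_conds (A\<inverse>) (B\<inverse>)" using conds by (simp add: all_conds_converse)
  fix b assume "b \<in> B\<inverse>"
  then have "prod.swap b \<in> B" and eq: "B\<inverse> - {b} = (B - {prod.swap b})\<inverse>" by auto
  then show "\<not> all_conds (A\<inverse>) (B\<inverse> - {b})"
    using irredundant unfolding eq all_conds_converse by blast
qed

lemma irrefl: "(i, j) \<in> A \<Longrightarrow> i \<noteq> j"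
  using A_arcs by (auto simp: arcs_def)

lemma tail_unique: "(i, j) \<in> A \<Longrightarrow> (i, k) \<in> A \<Longrightarrow> j = k"
  and head_unique: "(i, k) \<in> A \<Longrightarrow> (j, k) \<in> A \<Longrightarrow> i = j"
  using conds condC1_tail_eq_iff_head_eq[of A] unfolding all_conds_def by blast+

lemma cross:
  assumes "(i, j) \<in> A" "(k, l) \<in> A" "i \<noteq> k" "i \<noteq> l" "j \<noteq> k"
  shows "(i, l) \<in> B"
proof -
  have "distinct [i, j, k, l]"
    using assms irrefl[of i j] irrefl[of k l] head_unique[of i j k] by auto
  then show ?thesis using assms conds unfolding all_conds_def condC2_def by blast
qed

lemma C4: "(i, j) \<in> A \<Longrightarrow> (j, k) \<in> A \<Longrightarrow> i \<noteq> k \<Longrightarrow> C4_at B i j k"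
  using conds irrefl unfolding all_conds_def condC4_iff by auto

lemma C5: "(i, j) \<in> A \<Longrightarrow> (j, k) \<in> A \<Longrightarrow> (k, l) \<in> A \<Longrightarrow> distinct [i, j, k, l] \<Longrightarrow> C5_at B i j k l"
  using conds unfolding all_conds_def condC5_iff by blast

lemma needed:
  assumes "b \<in> B"
  obtains (C2) i j k l where "(i, j) \<in> A" "(k, l) \<in> A" "distinct [i, j, k, l]" "b = (i, l)"
  | (C4) i j k where "(i, j) \<in> A" "(j, k) \<in> A" "distinct [i, j, k]" "\<not> C4_at (B - {b}) i j k"
  | (C5) i j k l where "(i, j) \<in> A" "(j, k) \<in> A" "(k, l) \<in> A" "distinct [i, j, k, l]"
      "\<not> C5_at (B - {b}) i j k l"
proof -
  have "\<not> condC2 A (B - {b}) \<or> \<not> condC4 A (B - {b}) \<or> \<not> condC5 A (B - {b})"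
    using irredundant[OF assms] conds by (auto simp: all_conds_def)
  then show thesis
  proof (elim disjE)
    assume "\<not> condC2 A (B - {b})"
    then obtain i j k l where *: "(i, j) \<in> A" "(k, l) \<in> A" "distinct [i, j, k, l]" "(i, l) \<notin> B - {b}"
      unfolding condC2_def by blast
    moreover have "(i, l) \<in> B" using cross[of i j k l] * by auto
    ultimately show thesis using C2 by blast
  next
    assume "\<not> condC4 A (B - {b})"
    then show thesis using C4 unfolding condC4_iff by blast
  next
    assume "\<not> condC5 A (B - {b})"
    then show thesis using C5 unfolding condC5_iff by blast
  qed
qed

text \<open>
If \<open>i\<close> is a tail and \<open>q\<close> is no head, then C2 cannot require \<open>(i, q)\<close>, so C4 or C5 does, on some path of \<open>A\<close>.
Since \<open>q\<close> is no head, \<open>(i, q)\<close> has to leave the path at \<open>i\<close>. The only other possibility is that it is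
the middle arc of a two-step detour around a path, from \<open>i'\<close> to \<open>l'\<close> say; but then \<open>(i, l')\<close> is in \<open>B\<close> by
C2, and the detour over \<open>i\<close> alone makes \<open>(i, q)\<close> superfluous.
\<close>

lemma tail_needed:
  assumes iq: "(i, q) \<in> B" and ij: "(i, j) \<in> A" and q: "\<And>x. (x, q) \<notin> A"
  obtains k where "(j, k) \<in> A" "k \<noteq> i"
    "\<not> C4_at (B - {(i, q)}) i j k \<or>
     (\<exists>l. (k, l) \<in> A \<and> distinct [i, j, k, l] \<and> \<not> C5_at (B - {(i, q)}) i j k l) \<or>
     (\<exists>h. (h, i) \<in> A \<and> distinct [h, i, j, k] \<and> \<not> C5_at (B - {(i, q)}) h i j k)"
  using iq
proof (cases rule: needed)
  case (C2 i' j' k' l')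
  then show ?thesis using q by blast
next
  case (C4 i' j' k')
  then have "k' \<noteq> q" "k' \<noteq> i'" using q by auto
  then have "i' = i"
    using C4_at_critical[OF _ C4(4)] irredundant_pair.C4[OF irredundant_pair_axioms C4(1,2)] by auto
  then have "j' = j" using tail_unique[OF ij] C4(1) by simp
  then show ?thesis using that[of k'] C4 \<open>i' = i\<close> \<open>k' \<noteq> i'\<close> by blast
next
  case (C5 i' j' k' l')
  have ne: "k' \<noteq> q" "l' \<noteq> q" using C5 q by auto
  have "i' = i \<or> j' = i"
  proof (rule ccontr)
    assume no: "\<not> (i' = i \<or> j' = i)"
    obtain u v where uv: "u \<notin> {i', j', k', l'}" "(i', u) \<in> B" "(u, v) = (i, q)"
      using C5_at_critical[OF irredundant_pair.C5[OF irredundant_pair_axioms C5(1-4)] C5(5)] ne no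
      by auto
    have "j \<noteq> k'" "j \<noteq> l'"
      using head_unique[OF ij] C5(2,3) uv by auto
    then have "(i, l') \<in> B" using cross[OF ij C5(3)] uv by auto
    then have "C5_at (B - {(i, q)}) i' j' k' l'"
      using C5_at_detour_to_fourth[of i i' j' k' l' "B - {(i, q)}"] uv ne no by auto
    then show False using C5(5) by blast
  qed
  then show ?thesis
  proof
    assume "i' = i"
    moreover have "j' = j" using tail_unique[OF ij] C5(1) \<open>i' = i\<close> by simp
    ultimately show ?thesis using that[of k'] C5 by auto
  next
    assume "j' = i"
    moreover have "k' = j" using tail_unique[OF ij] C5(2) \<open>j' = i\<close> by simp
    ultimately show ?thesis using that[of l'] C5 by auto
  qed
qed

lemma head_needed:
  assumes pj: "(p, j) \<in> B" and ij: "(i, j) \<in> A" and p: "\<And>x. (p, x) \<notin> A"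
  obtains h where "(h, i) \<in> A" "h \<noteq> j"
    "\<not> C4_at (B - {(p, j)}) h i j \<or>
     (\<exists>g. (g, h) \<in> A \<and> distinct [g, h, i, j] \<and> \<not> C5_at (B - {(p, j)}) g h i j) \<or>
     (\<exists>k. (j, k) \<in> A \<and> distinct [h, i, j, k] \<and> \<not> C5_at (B - {(p, j)}) h i j k)"
proof -
  interpret dual: irredundant_pair "A\<inverse>" "B\<inverse>" by (rule dual)
  have eq: "B\<inverse> - {(j, p)} = (B - {(p, j)})\<inverse>" by auto
  obtain h where h: "(h, i) \<in> A" "h \<noteq> j" and *:
    "\<not> C4_at (B - {(p, j)}) h i j \<or>
     (\<exists>g. (g, h) \<in> A \<and> distinct [j, i, h, g] \<and> \<not> C5_at (B - {(p, j)}) g h i j) \<or>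
     (\<exists>k. (j, k) \<in> A \<and> distinct [k, j, i, h] \<and> \<not> C5_at (B - {(p, j)}) h i j k)"
    by (rule dual.tail_needed[of j p i, unfolded eq C4_at_converse C5_at_converse converse_iff])
      (use pj ij p in auto)
  from * have "\<not> C4_at (B - {(p, j)}) h i j \<or>
     (\<exists>g. (g, h) \<in> A \<and> distinct [g, h, i, j] \<and> \<not> C5_at (B - {(p, j)}) g h i j) \<or>
     (\<exists>k. (j, k) \<in> A \<and> distinct [h, i, j, k] \<and> \<not> C5_at (B - {(p, j)}) h i j k)"
    by (elim disjE) auto
  then show thesis using that[OF h] by blast
qed

end

section \<open>Blocked arcs and the exceptional pair\<close>

text \<open>
If \<open>(i, j)\<in>A\<close> avoids \<open>p\<close> and \<open>q\<close>, the two semiorders with three arcs that contain \<open>(i, j)\<close> and \<open>(p, q)\<close>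
contain \<open>(i, q)\<close> or \<open>(p, j)\<close> as third arc. For a blocked arc \<open>(p, q)\<close> none of these semiorders is tight.
An arc \<open>(i, j)\<close> of \<open>A\<close> with \<open>i \<noteq> q\<close> and \<open>j \<noteq> p\<close> is called free; as \<open>p\<close> is no tail and \<open>q\<close> is no head, it
avoids \<open>p\<close> and \<open>q\<close> altogether.
\<close>

locale blocked_arc = irredundant_pair A B for A B :: "('n::finite \<times> 'n) set" +
  fixes p q :: 'n
  assumes p_no_tail: "(p, x) \<notin> A" and q_no_head: "(x, q) \<notin> A" and p_ne_q: "p \<noteq> q"
    and pq_notin: "(p, q) \<notin> B"
    and blocked: "(i, j) \<in> A \<Longrightarrow> i \<noteq> q \<Longrightarrow> j \<noteq> p \<Longrightarrow> (i, q) \<in> B \<and> (p, j) \<in> B"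
begin

lemma dual_blocked: "blocked_arc (A\<inverse>) (B\<inverse>) q p"
proof -
  interpret dual: irredundant_pair "A\<inverse>" "B\<inverse>" by (rule dual)
  show ?thesis
    by unfold_locales (use p_no_tail q_no_head p_ne_q pq_notin blocked in auto)
qed

lemma free_tail_needed:
  assumes ij: "(i, j) \<in> A" and "i \<noteq> q" "j \<noteq> p"
  obtains k where "(j, k) \<in> A" "k \<noteq> i"
    "\<not> C4_at (B - {(i, q)}) i j k \<or>
     (\<exists>l. (k, l) \<in> A \<and> distinct [i, j, k, l] \<and> \<not> C5_at (B - {(i, q)}) i j k l) \<or>
     (\<exists>h. (h, i) \<in> A \<and> distinct [h, i, j, k] \<and> \<not> C5_at (B - {(i, q)}) h i j k)"
  by (rule tail_needed[OF _ ij q_no_head]) (use blocked[OF assms] in auto)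

lemma free_head_needed:
  assumes ij: "(i, j) \<in> A" and "i \<noteq> q" "j \<noteq> p"
  obtains h where "(h, i) \<in> A" "h \<noteq> j"
    "\<not> C4_at (B - {(p, j)}) h i j \<or>
     (\<exists>g. (g, h) \<in> A \<and> distinct [g, h, i, j] \<and> \<not> C5_at (B - {(p, j)}) g h i j) \<or>
     (\<exists>k. (j, k) \<in> A \<and> distinct [h, i, j, k] \<and> \<not> C5_at (B - {(p, j)}) h i j k)"
  by (rule head_needed[OF _ ij p_no_tail]) (use blocked[OF assms] in auto)

text \<open>
On such a path C2 yields \<open>(i, h)\<close> and \<open>(h, k)\<close>, so \<open>h\<close> is a detour from \<open>i\<close> to \<open>k\<close> and makes \<open>(i, q)\<close>
superfluous on the paths that start at \<open>i\<close>. On the path \<open>h, i, j, k\<close> the arc \<open>(i, q)\<close> could only be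
used together with \<open>(q, k)\<close>, but there \<open>(h, q)\<close> does the same service.
\<close>

lemma no_path5:
  assumes "(g, h) \<in> A" "(h, i) \<in> A" "(i, j) \<in> A" "(j, k) \<in> A" and "distinct [g, h, i, j, k]"
  shows False
proof -
  have ne: "h \<noteq> q" "i \<noteq> q" "j \<noteq> q" "k \<noteq> q" "h \<noteq> p" "i \<noteq> p" "j \<noteq> p"
    using assms q_no_head p_no_tail by auto
  have ih: "(i, h) \<in> B" and hk: "(h, k) \<in> B" and hq: "(h, q) \<in> B"
    using cross[OF assms(3,1)] cross[OF assms(2,4)] blocked[OF assms(2)] assms(5) ne by auto
  show False
  proof (rule free_tail_needed[OF assms(3) ne(2,7)])
    fix k' assume "(j, k') \<in> A"
    then have k': "k' = k" using tail_unique assms(4) by blast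
    assume "\<not> C4_at (B - {(i, q)}) i j k' \<or>
     (\<exists>l. (k', l) \<in> A \<and> distinct [i, j, k', l] \<and> \<not> C5_at (B - {(i, q)}) i j k' l) \<or>
     (\<exists>h. (h, i) \<in> A \<and> distinct [h, i, j, k'] \<and> \<not> C5_at (B - {(i, q)}) h i j k')"
    then show False
      unfolding k'
    proof (elim disjE exE conjE)
      assume "\<not> C4_at (B - {(i, q)}) i j k"
      then show False
        using C4_at_detour[of h i j k "B - {(i, q)}"] ih hk ne assms(5) by auto
    next
      fix l assume l: "(k, l) \<in> A" "\<not> C5_at (B - {(i, q)}) i j k l"
      have "l \<noteq> h" using head_unique[OF l(1)] assms(1,5) by auto
      then show False
        using C5_at_detour_to_third[of h i j k l "B - {(i, q)}"] l(2) ih hk ne assms(5) by auto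
    next
      fix h' assume h': "(h', i) \<in> A" "\<not> C5_at (B - {(i, q)}) h' i j k"
      then have "h' = h" using head_unique assms(2) by blast
      then have crit: "\<not> C5_at (B - {(i, q)}) h i j k" using h'(2) by simp
      have "C5_at B h i j k" using C5[OF assms(2-4)] assms(5) by auto
      from C5_at_critical[OF this crit] have "(q, k) \<in> B" "q \<notin> {h, i, j, k}"
        using ne assms(5) by auto
      then show False
        using C5_at_detour_to_fourth[of q h i j k "B - {(i, q)}"] crit hq assms(5) by auto
    qed
  qed
qed

text \<open>
On the path \<open>i, j, k\<close> both \<open>(i, q)\<close> and \<open>(p, k)\<close> would have to be indispensable for C4, but a single
element provides the detour, and \<open>p \<noteq> q\<close>.
\<close>

lemma no_cycle3:
  assumes "(i, j) \<in> A" "(j, k) \<in> A" "(k, i) \<in> A" and "distinct [i, j, k]"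
  shows False
proof -
  have ne: "i \<noteq> q" "j \<noteq> q" "k \<noteq> q" "i \<noteq> p" "j \<noteq> p" "k \<noteq> p"
    using assms q_no_head p_no_tail by auto
  have tail: "\<not> C4_at (B - {(i, q)}) i j k"
  proof (rule free_tail_needed[OF assms(1) ne(1,5)])
    fix k' assume "(j, k') \<in> A"
    then have k': "k' = k" using tail_unique assms(2) by blast
    assume "\<not> C4_at (B - {(i, q)}) i j k' \<or>
     (\<exists>l. (k', l) \<in> A \<and> distinct [i, j, k', l] \<and> \<not> C5_at (B - {(i, q)}) i j k' l) \<or>
     (\<exists>h. (h, i) \<in> A \<and> distinct [h, i, j, k'] \<and> \<not> C5_at (B - {(i, q)}) h i j k')"
    then show ?thesis
      unfolding k' using tail_unique[OF assms(3)] head_unique[OF assms(3)] by auto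
  qed
  have head: "\<not> C4_at (B - {(p, k)}) i j k"
  proof (rule free_head_needed[OF assms(2) ne(2,6)])
    fix h assume "(h, j) \<in> A"
    then have h: "h = i" using head_unique assms(1) by blast
    assume "\<not> C4_at (B - {(p, k)}) h j k \<or>
     (\<exists>g. (g, h) \<in> A \<and> distinct [g, h, j, k] \<and> \<not> C5_at (B - {(p, k)}) g h j k) \<or>
     (\<exists>k'. (k, k') \<in> A \<and> distinct [h, j, k, k'] \<and> \<not> C5_at (B - {(p, k)}) h j k k')"
    then show ?thesis
      unfolding h using tail_unique[OF assms(3)] head_unique[OF assms(3)] by auto
  qed
  have "C4_at B i j k" using C4[OF assms(1,2)] assms(4) by auto
  from C4_at_critical[OF this tail] have "(i, q) \<in> B" "(q, k) \<in> B" "q \<notin> {i, j, k}"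
    using ne by auto
  then show False
    using C4_at_detour[of q i j k "B - {(p, k)}"] head p_ne_q ne by auto
qed

definition cycle4 where
  "cycle4 h i j k \<longleftrightarrow> (h, i) \<in> A \<and> (i, j) \<in> A \<and> (j, k) \<in> A \<and> (k, h) \<in> A \<and> distinct [h, i, j, k]"

lemma cycle4_rotate: "cycle4 h i j k \<Longrightarrow> cycle4 i j k h"
  by (auto simp: cycle4_def)

text \<open>
A free arc extends to a path \<open>h, i, j, k\<close>. If \<open>h \<noteq> q\<close>, the arc \<open>(h, i)\<close> is free too and the path extends
backwards, to a 4-cycle or to a path excluded by \<open>no_path5\<close>; likewise forwards if \<open>k \<noteq> p\<close>.
\<close>

lemma free_arc:
  assumes ij: "(i, j) \<in> A" and i: "i \<noteq> q" and j: "j \<noteq> p"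
  shows "(q, i) \<in> A \<and> (j, p) \<in> A \<or> (\<exists>a b c d. cycle4 a b c d)"
proof -
  obtain k where jk: "(j, k) \<in> A" "k \<noteq> i" by (rule free_tail_needed[OF assms])
  obtain h where hi: "(h, i) \<in> A" "h \<noteq> j" by (rule free_head_needed[OF assms])
  have ne: "i \<noteq> j" "j \<noteq> k" "h \<noteq> i" using irrefl ij jk hi by auto
  have "h \<noteq> k" using no_cycle3[OF ij jk(1)] hi jk(2) ne by auto
  then have hijk: "distinct [h, i, j, k]" using hi jk(2) ne by auto
  have pq: "i \<noteq> p" "j \<noteq> q" using p_no_tail q_no_head ij by auto
  have k: "\<exists>a b c d. cycle4 a b c d" if "k \<noteq> p"
  proof (rule free_tail_needed[OF jk(1) pq(2) that])
    fix l assume l: "(k, l) \<in> A" "l \<noteq> j"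
    show ?thesis
    proof (cases "l = h")
      case True
      then have "cycle4 h i j k" using hi ij jk l hijk by (simp add: cycle4_def)
      then show ?thesis by blast
    next
      case False
      moreover have "l \<noteq> i" using head_unique[OF l(1)] hi(1) \<open>h \<noteq> k\<close> by blast
      ultimately have "distinct [h, i, j, k, l]" using hijk l(2) irrefl[OF l(1)] by auto
      then show ?thesis using no_path5[OF hi(1) ij jk(1) l(1)] by blast
    qed
  qed
  have h: "\<exists>a b c d. cycle4 a b c d" if "h \<noteq> q"
  proof (rule free_head_needed[OF hi(1) that pq(1)])
    fix g assume g: "(g, h) \<in> A" "g \<noteq> i"
    show ?thesis
    proof (cases "g = k")
      case True
      then have "cycle4 h i j k" using hi ij jk g hijk by (simp add: cycle4_def)
      then show ?thesis by blast
    next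
      case False
      moreover have "g \<noteq> j" using tail_unique[OF g(1)] jk(1) \<open>h \<noteq> k\<close> by blast
      ultimately have "distinct [g, h, i, j, k]" using hijk g(2) irrefl[OF g(1)] by auto
      then show ?thesis using no_path5[OF g(1) hi(1) ij jk(1)] by blast
    qed
  qed
  show ?thesis using h k hi(1) jk(1) by blast
qed

lemma cycle4D:
  assumes "cycle4 h i j k"
  shows "(h, i) \<in> A" "(i, j) \<in> A" "(j, k) \<in> A" "(k, h) \<in> A" "distinct [h, i, j, k]"
    "distinct [h, i, j, k, p, q]"
    "(h, q) \<in> B" "(i, q) \<in> B" "(j, q) \<in> B" "(k, q) \<in> B"
    "(p, h) \<in> B" "(p, i) \<in> B" "(p, j) \<in> B" "(p, k) \<in> B"
    "(h, k) \<in> B" "(i, h) \<in> B" "(j, i) \<in> B" "(k, j) \<in> B"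
proof -
  show *: "(h, i) \<in> A" "(i, j) \<in> A" "(j, k) \<in> A" "(k, h) \<in> A" "distinct [h, i, j, k]"
    using assms by (auto simp: cycle4_def)
  show d: "distinct [h, i, j, k, p, q]" using * p_no_tail q_no_head p_ne_q by auto
  show "(h, q) \<in> B" "(i, q) \<in> B" "(j, q) \<in> B" "(k, q) \<in> B"
    "(p, h) \<in> B" "(p, i) \<in> B" "(p, j) \<in> B" "(p, k) \<in> B"
    using *(1-4)[THEN blocked] d by auto
  show "(h, k) \<in> B" "(i, h) \<in> B" "(j, i) \<in> B" "(k, j) \<in> B"
    using cross[OF *(1,3)] cross[OF *(2,4)] cross[OF *(3,1)] cross[OF *(4,2)] d by auto
qed

text \<open>
The arc \<open>(p, k)\<close> is not needed for C4, where C2 provides a detour over \<open>h\<close>. With \<open>(q, k)\<close> in \<open>B\<close>, the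
element \<open>q\<close> would be a detour on both paths on which \<open>(p, k)\<close> could be needed for C5.
\<close>

lemma cycle4_q_notin:
  assumes "cycle4 h i j k"
  shows "(q, k) \<notin> B"
proof
  note c = cycle4D[OF assms]
  assume qk: "(q, k) \<in> B"
  show False
  proof (rule free_head_needed[OF c(3)])
    show "j \<noteq> q" "k \<noteq> p" using c(6) by auto
    fix i' assume "(i', j) \<in> A"
    then have i': "i' = i" using head_unique c(2) by blast
    assume "\<not> C4_at (B - {(p, k)}) i' j k \<or>
     (\<exists>g. (g, i') \<in> A \<and> distinct [g, i', j, k] \<and> \<not> C5_at (B - {(p, k)}) g i' j k) \<or>
     (\<exists>l. (k, l) \<in> A \<and> distinct [i', j, k, l] \<and> \<not> C5_at (B - {(p, k)}) i' j k l)"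
    then show False
      unfolding i'
    proof (elim disjE exE conjE)
      assume "\<not> C4_at (B - {(p, k)}) i j k"
      then show False using C4_at_detour[of h i j k "B - {(p, k)}"] c by auto
    next
      fix g assume g: "(g, i) \<in> A" "\<not> C5_at (B - {(p, k)}) g i j k"
      then have "g = h" using head_unique c(1) by blast
      then show False using g C5_at_detour_to_fourth[of q h i j k "B - {(p, k)}"] c qk by auto
    next
      fix l assume l: "(k, l) \<in> A" "\<not> C5_at (B - {(p, k)}) i j k l"
      then have "l = h" using tail_unique c(4) by blast
      then show False using l C5_at_detour_to_third[of q i j k h "B - {(p, k)}"] c qk by auto
    qed
  qed
qed

lemma cycle4_q_notins:
  assumes "cycle4 h i j k"
  shows "(q, h) \<notin> B" "(q, i) \<notin> B" "(q, j) \<notin> B" "(q, k) \<notin> B"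
  using cycle4_q_notin cycle4_rotate assms by blast+

text \<open>
On a 4-cycle, C4 follows from the arcs given by C2, and \<open>q\<close> has no arc of \<open>B\<close> back to the cycle; so the
path that starts at \<open>h\<close> is the only one on which \<open>(h, q)\<close> can be needed.
\<close>

lemma cycle4_tail_critical:
  assumes "cycle4 h i j k"
  shows "\<not> C5_at (B - {(h, q)}) h i j k"
proof -
  note c = cycle4D[OF assms] and nq = cycle4_q_notins[OF assms]
  show ?thesis
  proof (rule free_tail_needed[OF c(1)])
    show "h \<noteq> q" "i \<noteq> p" using c(6) by auto
    fix j' assume "(i, j') \<in> A"
    then have j': "j' = j" using tail_unique c(2) by blast
    assume "\<not> C4_at (B - {(h, q)}) h i j' \<or>
     (\<exists>l. (j', l) \<in> A \<and> distinct [h, i, j', l] \<and> \<not> C5_at (B - {(h, q)}) h i j' l) \<or>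
     (\<exists>g. (g, h) \<in> A \<and> distinct [g, h, i, j'] \<and> \<not> C5_at (B - {(h, q)}) g h i j')"
    then show ?thesis
      unfolding j'
    proof (elim disjE exE conjE)
      assume "\<not> C4_at (B - {(h, q)}) h i j"
      then show ?thesis using C4_at_detour[of k h i j "B - {(h, q)}"] c by auto
    next
      fix l assume l: "(j, l) \<in> A" "\<not> C5_at (B - {(h, q)}) h i j l"
      then have "l = k" using tail_unique c(3) by blast
      then show ?thesis using l by simp
    next
      fix g assume g: "(g, h) \<in> A" "\<not> C5_at (B - {(h, q)}) g h i j"
      then have "g = k" using head_unique c(4) by blast
      then have crit: "\<not> C5_at (B - {(h, q)}) k h i j" using g by simp
      have "C5_at B k h i j" using C5[OF c(4,1,2)] c(5) by auto
      from C5_at_critical[OF this crit] have "(q, j) \<in> B" using c(6) by auto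
      then show ?thesis using nq by blast
    qed
  qed
qed

lemma dual_cycle4: "blocked_arc.cycle4 (A\<inverse>) k j i h \<longleftrightarrow> cycle4 h i j k"
proof -
  interpret dual: blocked_arc "A\<inverse>" "B\<inverse>" q p by (rule dual_blocked)
  show ?thesis unfolding cycle4_def dual.cycle4_def by auto
qed

lemma cycle4_head_critical:
  assumes "cycle4 h i j k"
  shows "\<not> C5_at (B - {(p, k)}) h i j k"
proof -
  interpret dual: blocked_arc "A\<inverse>" "B\<inverse>" q p by (rule dual_blocked)
  have eq: "B\<inverse> - {(k, p)} = (B - {(p, k)})\<inverse>" by auto
  show ?thesis
    using dual.cycle4_tail_critical[of k j i h] assms unfolding dual_cycle4 eq C5_at_converse by blast
qed

lemma cycle4_p_notin: "cycle4 h i j k \<Longrightarrow> (h, p) \<notin> B"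
proof -
  assume "cycle4 h i j k"
  interpret dual: blocked_arc "A\<inverse>" "B\<inverse>" q p by (rule dual_blocked)
  show ?thesis
    using dual.cycle4_q_notin[of k j i h] \<open>cycle4 h i j k\<close> unfolding dual_cycle4 by simp
qed

text \<open>
The path \<open>h, i, j, k\<close> needs both \<open>(h, q)\<close> and \<open>(p, k)\<close>, so the same detour contains both of them, and it
can only be \<open>h, q, p, k\<close>.
\<close>

lemma cycle4_qp:
  assumes "cycle4 h i j k"
  shows "(q, p) \<in> B"
proof -
  note c = cycle4D[OF assms] and nq = cycle4_q_notins[OF assms]
  have "C5_at B h i j k" using C5[OF c(1-3)] c(5) by auto
  from C5_at_critical[OF this cycle4_tail_critical[OF assms]]
  obtain v where v: "v \<notin> {h, i, j, k}" "(q, v) \<in> B" "(v, k) \<in> B"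
    using c(6) nq by auto
  have "v = p"
  proof (rule ccontr)
    assume "v \<noteq> p"
    then have "C5_at (B - {(p, k)}) h i j k"
      using C5_at_two_step_detour[of q h i j k v "B - {(p, k)}"] v c by auto
    then show False using cycle4_head_critical[OF assms] by blast
  qed
  then show ?thesis using v by simp
qed

text \<open>
Any other arc \<open>(x, y)\<close> of \<open>A\<close> would be free and hence would have a successor \<open>(y, z)\<close>; then C2 makes \<open>y\<close> a
detour from \<open>h\<close> to \<open>j\<close>, and \<open>(h, q)\<close> is no longer needed.
\<close>

lemma cycle4_A:
  assumes "cycle4 h i j k"
  shows "A = {(h, i), (i, j), (j, k), (k, h)}"
proof (rule ccontr)
  note c = cycle4D[OF assms] and nq = cycle4_q_notins[OF assms]
  assume "A \<noteq> {(h, i), (i, j), (j, k), (k, h)}"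
  then obtain x y where xy: "(x, y) \<in> A" "(x, y) \<notin> {(h, i), (i, j), (j, k), (k, h)}"
    using c(1-4) by auto
  have x: "x \<notin> {h, i, j, k}" using tail_unique[OF xy(1)] xy(2) c(1-4) by blast
  have y: "y \<notin> {h, i, j, k}" using head_unique[OF xy(1)] xy(2) c(1-4) by blast
  have "(x, k) \<in> B" "(h, y) \<in> B"
    using cross[OF xy(1) c(3)] cross[OF c(1) xy(1)] x y by auto
  then have "x \<noteq> q" "y \<noteq> p" using nq cycle4_p_notin[OF assms] by auto
  then obtain z where yz: "(y, z) \<in> A" using free_tail_needed[OF xy(1)] by blast
  have "z \<noteq> i" using head_unique[of y i h] yz c(1) y by blast
  then have "(y, j) \<in> B" using cross[OF yz c(2)] y by auto
  moreover have "y \<noteq> q" using q_no_head xy by blast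
  ultimately have "C5_at (B - {(h, q)}) h i j k"
    using C5_at_detour_to_third[of y h i j k "B - {(h, q)}"] \<open>(h, y) \<in> B\<close> y by auto
  then show False using cycle4_tail_critical[OF assms] by blast
qed

text \<open>
The thirteen arcs are all forced, and they satisfy the conditions by themselves, so irredundancy
leaves no room for a further arc.
\<close>

lemma cycle4_B:
  assumes "cycle4 h i j k"
  shows "B = {(i, h), (j, i), (k, j), (h, k), (p, h), (p, i), (p, j), (p, k), (q, p),
    (h, q), (i, q), (j, q), (k, q)}"
proof (rule ccontr)
  note c = cycle4D[OF assms] and A = cycle4_A[OF assms]
  define B0 where "B0 = {(i, h), (j, i), (k, j), (h, k), (p, h), (p, i), (p, j), (p, k), (q, p),
    (h, q), (i, q), (j, q), (k, q)}"
  have sub: "B0 \<subseteq> B" using c cycle4_qp[OF assms] by (simp add: B0_def)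
  assume "\<not> ?thesis"
  then have "B \<noteq> B0" by (simp add: B0_def)
  then obtain b where b: "b \<in> B" "B0 \<subseteq> B - {b}" using sub by blast
  have ne: "h \<noteq> i" "h \<noteq> j" "h \<noteq> k" "i \<noteq> j" "i \<noteq> k" "j \<noteq> k" using c(5) by auto
  have mem: "(h, k) \<in> B0" "(i, h) \<in> B0" "(j, i) \<in> B0" "(k, j) \<in> B0" "(q, p) \<in> B0"
    and memx: "x \<in> {h, i, j, k} \<Longrightarrow> (x, q) \<in> B0 \<and> (p, x) \<in> B0" for x
    by (auto simp: B0_def)
  have "condC2 A B0"
    unfolding condC2_def
  proof (intro allI impI, elim conjE)
    fix a b d e assume "(a, b) \<in> A" "(d, e) \<in> A" "distinct [a, b, d, e]"
    then have "(a, e) \<in> {(h, k), (i, h), (j, i), (k, j)}"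
      unfolding A using ne by auto
    then show "(a, e) \<in> B0" using mem by blast
  qed
  moreover have "condC4 A B0"
    unfolding condC4_iff
  proof (intro allI impI, elim conjE)
    fix a b d assume "(a, b) \<in> A" "(b, d) \<in> A" "distinct [a, b, d]"
    then consider "(a, b, d) = (h, i, j)" | "(a, b, d) = (i, j, k)" | "(a, b, d) = (j, k, h)"
      | "(a, b, d) = (k, h, i)"
      unfolding A using ne by auto
    then show "C4_at B0 a b d"
      using C4_at_detour[of k h i j B0] C4_at_detour[of h i j k B0] C4_at_detour[of i j k h B0]
        C4_at_detour[of j k h i B0] ne mem by cases simp_all
  qed
  moreover have "condC5 A B0"
    unfolding condC5_iff
  proof (intro allI impI, elim conjE)
    fix a b d e assume *: "(a, b) \<in> A" "(b, d) \<in> A" "(d, e) \<in> A" "distinct [a, b, d, e]"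
    have set: "a \<in> {h, i, j, k}" "b \<in> {h, i, j, k}" "d \<in> {h, i, j, k}" "e \<in> {h, i, j, k}"
      using *(1-3) unfolding A by auto
    show "C5_at B0 a b d e"
      using C5_at_two_step_detour[of q a b d e p B0] set memx[OF set(1)] memx[OF set(4)] mem(5) c(6) by auto
  qed
  ultimately have "all_conds A B0" using conds by (simp add: all_conds_def)
  then show False using all_conds_mono[OF _ b(2)] irredundant[OF b(1)] by blast
qed

text \<open>
The blocked arc \<open>(p, q)\<close> plays the role of \<open>(5, 6)\<close>. The relabelling on \<open>{7..CARD('n)}\<close> is arbitrary.
\<close>

lemma exceptional_if_cycle4:
  assumes "cycle4 h i j k"
  shows "exceptional A B"
proof -
  let ?X = "{h, i, j, k, p, q}"
  have d: "distinct [h, i, j, k, p, q]" by (rule cycle4D[OF assms])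
  then have card_X: "card ?X = 6" by simp
  then have card6: "6 \<le> CARD('n)" using card_mono[of "UNIV :: 'n set" ?X] by simp
  define s where "s m = [h, i, j, k, p, q] ! (m - 1)" for m
  have s: "s 1 = h" "s 2 = i" "s 3 = j" "s 4 = k" "s 5 = p" "s 6 = q"
    by (simp_all add: s_def)
  have six: "{1..6} = {1, 2, 3, 4, 5, 6::nat}" by auto
  have s_bij: "bij_betw s {1..6} ?X"
    unfolding six bij_betw_def inj_on_def using s d by auto
  have "card {7..CARD('n)} = card (UNIV - ?X)"
    using card_X card6 by (simp add: card_Diff_subset)
  then obtain t where t_bij: "bij_betw t {7..CARD('n)} (UNIV - ?X)"
    using finite_same_card_bij[of "{7..CARD('n)}" "UNIV - ?X"] by auto
  define \<sigma> where "\<sigma> m = (if m \<in> {1..6} then s m else t m)" for m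
  have "bij_betw \<sigma> {1..6} ?X"
    using s_bij by (rule bij_betw_cong[THEN iffD1, rotated]) (simp add: \<sigma>_def)
  moreover have "bij_betw \<sigma> {7..CARD('n)} (UNIV - ?X)"
    using t_bij by (rule bij_betw_cong[THEN iffD1, rotated]) (auto simp: \<sigma>_def)
  ultimately have "bij_betw \<sigma> ({1..6} \<union> {7..CARD('n)}) (?X \<union> (UNIV - ?X))"
    by (rule bij_betw_combine) auto
  moreover have "{1..6} \<union> {7..CARD('n)} = {1..CARD('n)}" using card6 by auto
  ultimately have "bij_betw \<sigma> {1..CARD('n)} UNIV" by (simp add: Un_commute)
  moreover have \<sigma>: "\<sigma> 1 = h" "\<sigma> 2 = i" "\<sigma> 3 = j" "\<sigma> 4 = k" "\<sigma> 5 = p" "\<sigma> 6 = q"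
    using s by (simp_all add: \<sigma>_def)
  have "A = map_prod \<sigma> \<sigma> ` A6" "B = map_prod \<sigma> \<sigma> ` B6"
    unfolding cycle4_A[OF assms] cycle4_B[OF assms] A6_def B6_def using \<sigma>
    by (simp_all only: image_insert image_empty map_prod_simp)
  ultimately show ?thesis using card6 unfolding exceptional_def by blast
qed

end

section \<open>Linear functionals that vanish on the tight semiorders\<close>

locale vanishing_functional = irredundant_pair A B for A B :: "('n::finite \<times> 'n) set" +
  fixes c :: "'n \<times> 'n \<Rightarrow> real"
  assumes vanishes: "semiorder S \<Longrightarrow> card (S \<inter> A) = card (S \<inter> B) + 1 \<Longrightarrow> sum c S = 0"
    and not_exceptional: "\<not> exceptional A B" and B_ne: "B \<noteq> {}"
begin

lemma valid: "semiorder S \<Longrightarrow> card (S \<inter> A) \<le> card (S \<inter> B) + 1"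
  using valid_if_all_conds[OF A_arcs conds] by (simp add: valid_for_semiorders_def)

text \<open>
By validity a lower bound on \<open>card (S \<inter> A)\<close> suffices for \<open>S\<close> to be tight.
\<close>

lemma isolate:
  assumes "semiorder S" "card (S \<inter> B) < card (S \<inter> A)" "e \<in> S" "\<And>x. x \<in> S \<Longrightarrow> x \<noteq> e \<Longrightarrow> c x = 0"
  shows "c e = 0"
proof -
  have "card (S \<inter> A) = card (S \<inter> B) + 1" using valid[OF assms(1)] assms(2) by simp
  then have "sum c S = 0" using vanishes assms(1) by blast
  moreover have "sum c S = c e + sum c (S - {e})" using assms(3) by (simp add: sum.remove)
  moreover have "sum c (S - {e}) = 0" using assms(4) by (simp add: sum.neutral)
  ultimately show ?thesis by simp
qed

lemma isolate_one:
  assumes "semiorder S" "S \<inter> B = {}" "a \<in> A" "a \<in> S" "e \<in> S" "\<And>x. x \<in> S \<Longrightarrow> x \<noteq> e \<Longrightarrow> c x = 0"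
  shows "c e = 0"
proof (rule isolate[OF assms(1) _ assms(5,6)])
  have "S \<inter> A \<noteq> {}" using assms(3,4) by blast
  then have "0 < card (S \<inter> A)" by (simp add: card_gt_0_iff)
  then show "card (S \<inter> B) < card (S \<inter> A)" using assms(2) by simp
qed

lemma isolate_two:
  assumes "semiorder S" "S \<inter> B \<subseteq> {b}" "{a, a'} \<subseteq> S \<inter> A" "a \<noteq> a'" "e \<in> S"
    "\<And>x. x \<in> S \<Longrightarrow> x \<noteq> e \<Longrightarrow> c x = 0"
  shows "c e = 0"
proof (rule isolate[OF assms(1) _ assms(5,6)])
  have "card {a, a'} \<le> card (S \<inter> A)" using assms(3) by (intro card_mono) auto
  moreover have "card (S \<inter> B) \<le> card {b}" using assms(2) by (intro card_mono) auto
  ultimately show "card (S \<inter> B) < card (S \<inter> A)" using assms(4) by simp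
qed

lemma zero_A: "a \<in> A \<Longrightarrow> c a = 0"
proof -
  assume a: "a \<in> A"
  obtain i j where ij: "a = (i, j)" by (cases a)
  show ?thesis
    by (rule isolate_one[of "{a}" a]) (use a ij irrefl[of i j] disj semiorder_singleton[of i j] in auto)
qed

lemma zero_tail: "c (i, q) = 0" if "(i, j) \<in> A" "i \<noteq> q" "(i, q) \<notin> B"
  by (rule isolate_one[of "{(i, j), (i, q)}" "(i, j)"])
    (use that disj irrefl zero_A semiorder_common_tail[of i j q] in auto)

lemma zero_head: "c (p, j) = 0" if "(i, j) \<in> A" "p \<noteq> j" "(p, j) \<notin> B"
  by (rule isolate_one[of "{(i, j), (p, j)}" "(i, j)"])
    (use that disj irrefl zero_A semiorder_common_head[of i j p] in auto)

lemma zero_cross: "c (i, l) = 0" if "(i, j) \<in> A" "(k, l) \<in> A" "distinct [i, j, k, l]"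
  by (rule isolate_two[OF semiorder_two_arcs[OF that(3)], of "(i, l)" "(i, j)" "(k, l)"])
    (use that disj zero_A in auto)

text \<open>
The semiorder that violates the inequality of \<open>B - {b}\<close> respects that of \<open>B\<close>, so it contains \<open>b\<close> and
is tight. Its other arcs avoid \<open>B\<close> and start at the tail \<open>i\<close> or end at the head \<open>k\<close>, where \<open>c\<close>
is zero already.
\<close>

lemma zero_C4_critical:
  assumes ij: "(i, j) \<in> A" and jk: "(j, k) \<in> A" and "i \<noteq> k" and crit: "\<not> C4_at (B - {b}) i j k"
  shows "c b = 0"
proof -
  have d: "distinct [i, j, k]" using assms irrefl by auto
  obtain S where S: "semiorder S" "(i, j) \<in> S" "(j, k) \<in> S" "S \<inter> (B - {b}) = {}"
    and ends: "\<forall>(x, y)\<in>S. x = i \<or> y = k"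
    using C4_violator[OF d _ _ crit] ij jk disj by blast
  have two: "{(i, j), (j, k)} \<subseteq> S \<inter> A" using S ij jk by auto
  have "card {(i, j), (j, k)} \<le> card (S \<inter> A)" using two by (intro card_mono) auto
  then have "S \<inter> B \<noteq> {}" using valid[OF S(1)] d by auto
  then have "b \<in> S" using S(4) by blast
  show ?thesis
  proof (rule isolate_two[OF S(1) _ two _ \<open>b \<in> S\<close>])
    show "S \<inter> B \<subseteq> {b}" using S(4) by blast
    show "(i, j) \<noteq> (j, k)" using d by auto
    fix x assume x: "x \<in> S" "x \<noteq> b"
    obtain u v where uv: "x = (u, v)" by (cases x)
    have "x \<notin> B" "u \<noteq> v" using S(1,4) x uv by (auto simp: semiorder_def arcs_def)
    moreover have "u = i \<or> v = k" using ends x(1) uv by auto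
    ultimately show "c x = 0" using zero_tail[OF ij, of v] zero_head[OF jk, of u] uv by auto
  qed
qed

lemma zero_unblocked:
  assumes "(i, j) \<in> A" "distinct [i, j, p, q]" "(p, q) \<notin> B" "(i, q) \<notin> B \<or> (p, j) \<notin> B"
  shows "c (p, q) = 0"
  using assms(4)
proof
  assume iq: "(i, q) \<notin> B"
  show ?thesis
    by (rule isolate_one[OF semiorder_two_arcs[OF assms(2)], of "(i, j)"])
      (use assms iq disj zero_A zero_tail[of i j q] in auto)
next
  assume pj: "(p, j) \<notin> B"
  have "distinct [p, q, i, j]" using assms(2) by auto
  then show ?thesis
    by (rule isolate_one[OF semiorder_two_arcs, of _ _ _ _ "(i, j)"])
      (use assms pj disj zero_A zero_head[of i j p] in auto)
qed

text \<open>
Here \<open>A\<close> consists of the path \<open>q, i, j, p\<close>. The chain \<open>p, q, i, j\<close> with all further elements in the low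
position contains two arcs of \<open>A\<close> and, apart from \<open>(p, j)\<close>, no arc of \<open>B\<close>; since \<open>(p, j)\<close> is needed for
C4 on \<open>q, i, j\<close>, the functional vanishes there.
\<close>

lemma zero_blocked_path:
  assumes "blocked_arc A B p q" and qi: "(q, i) \<in> A" and ij: "(i, j) \<in> A" and jp: "(j, p) \<in> A"
  shows "c (p, q) = 0"
proof -
  interpret blocked_arc A B p q by fact
  have d: "distinct [p, q, i, j]"
    using irrefl[OF qi] irrefl[OF ij] irrefl[OF jp] p_ne_q p_no_tail q_no_head ij qi jp by auto
  have free: "i \<noteq> q" "j \<noteq> p" using d by auto
  have tails: "x \<in> {q, i, j}" if xy: "(x, y) \<in> A" for x y
  proof (cases "x = q \<or> y = p")
    case True
    then show ?thesis using head_unique[OF xy] jp by auto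
  next
    case False
    then have "(q, x) \<in> A"
      using free_arc[OF xy] exceptional_if_cycle4 not_exceptional by blast
    then show ?thesis using tail_unique[OF qi] by auto
  qed
  have qp: "(q, p) \<in> B" using cross[OF qi jp] d by auto
  have pj: "(p, j) \<in> B" using blocked[OF ij] d by auto
  have xi: "(x, i) \<notin> B" if x: "x \<notin> {q, i, j}" for x
  proof
    assume "(x, i) \<in> B"
    show False
      by (rule head_needed[OF \<open>(x, i) \<in> B\<close> qi]) (use tails x q_no_head in blast)+
  qed
  have crit: "\<not> C4_at (B - {(p, j)}) q i j"
  proof (rule free_head_needed[OF ij free])
    fix h assume "(h, i) \<in> A"
    then have h: "h = q" using head_unique qi by blast
    assume "\<not> C4_at (B - {(p, j)}) h i j \<or>
     (\<exists>g. (g, h) \<in> A \<and> distinct [g, h, i, j] \<and> \<not> C5_at (B - {(p, j)}) g h i j) \<or>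
     (\<exists>k. (j, k) \<in> A \<and> distinct [h, i, j, k] \<and> \<not> C5_at (B - {(p, j)}) h i j k)"
    then show ?thesis
      unfolding h
    proof (elim disjE exE conjE)
      fix k assume k: "(j, k) \<in> A" "\<not> C5_at (B - {(p, j)}) q i j k"
      then have "k = p" using tail_unique jp by blast
      then have crit: "\<not> C5_at (B - {(p, j)}) q i j p" using k by simp
      have "C5_at B q i j p" using C5[OF qi ij jp] d by auto
      from C5_at_critical[OF this crit] show ?thesis using d by auto
    qed (use q_no_head in auto)
  qed
  have qj: "(q, j) \<notin> B" using crit d by (auto simp: C4_at_def)
  have lj: "(l, j) \<notin> B" if l: "l \<notin> {q, i, j, p}" for l
  proof
    assume lj: "(l, j) \<in> B"
    show False
    proof (rule head_needed[OF lj ij])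
      show "(l, x) \<notin> A" for x using tails l by blast
      fix h assume "(h, i) \<in> A"
      then have h: "h = q" using head_unique qi by blast
      assume "\<not> C4_at (B - {(l, j)}) h i j \<or>
       (\<exists>g. (g, h) \<in> A \<and> distinct [g, h, i, j] \<and> \<not> C5_at (B - {(l, j)}) g h i j) \<or>
       (\<exists>k. (j, k) \<in> A \<and> distinct [h, i, j, k] \<and> \<not> C5_at (B - {(l, j)}) h i j k)"
      then show False
        unfolding h
      proof (elim disjE exE conjE)
        assume "\<not> C4_at (B - {(l, j)}) q i j"
        then show False using C4_at_detour[of p q i j "B - {(l, j)}"] qp pj l d by auto
      next
        fix k assume k: "(j, k) \<in> A" "\<not> C5_at (B - {(l, j)}) q i j k"
        then have "k = p" using tail_unique jp by blast
        then have crit5: "\<not> C5_at (B - {(l, j)}) q i j p" using k by simp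
        have "C5_at B q i j p" using C5[OF qi ij jp] d by auto
        from C5_at_critical[OF this crit5] have "(q, l) \<in> B" using d l by auto
        then show False using crit C4_at_detour[of l q i j "B - {(p, j)}"] lj l d by auto
      qed (use q_no_head in auto)
    qed
  qed
  show ?thesis
  proof (rule semiorder_chain4[OF d, of UNIV "{}"])
    fix S
    assume S: "semiorder S" "(p, q) \<in> S" "(q, i) \<in> S" "(i, j) \<in> S"
      and mem: "\<And>x y. (x, y) \<in> S \<Longrightarrow> (x, y) \<in> {(p, q), (q, i), (i, j), (p, i), (q, j), (p, j)} \<or>
        x \<in> UNIV - {p, q, i, j} \<and> y \<in> {i, j} \<or>
        y \<in> {} - {p, q, i, j} \<and> x \<in> {p, q} \<or>
        x \<in> UNIV - {p, q, i, j} \<and> y \<in> {} - {p, q, i, j} \<or>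
        y \<notin> UNIV \<union> {} \<union> {p, q, i, j} \<and> x = p \<or> x \<notin> UNIV \<union> {} \<union> {p, q, i, j} \<and> y = j"
    have mem': "e = (p, q) \<or> e = (p, j) \<or> e \<in> A \<or> e = (q, j) \<or> e = (p, i) \<or>
        (\<exists>x. x \<notin> {p, q, i, j} \<and> (e = (x, i) \<or> e = (x, j)))" if "e \<in> S" for e
      using mem[of "fst e" "snd e"] that qi ij by (cases e) auto
    show ?thesis
    proof (rule isolate_two[OF S(1) _ _ _ S(2), of "(p, j)" "(q, i)" "(i, j)"])
      have "e = (p, j)" if "e \<in> S" "e \<in> B" for e
        using mem'[OF that(1)] that(2) pq_notin disj qj xi lj d by auto
      then show "S \<inter> B \<subseteq> {(p, j)}" by blast
      show "{(q, i), (i, j)} \<subseteq> S \<inter> A" "(q, i) \<noteq> (i, j)" using S qi ij d by auto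
      have "c (p, j) = 0" by (rule zero_C4_critical[OF qi ij _ crit]) (use d in auto)
      moreover have "c (q, j) = 0" by (rule zero_tail[OF qi _ qj]) (use d in auto)
      moreover have "c (x, i) = 0" if "x \<notin> {q, i, j}" for x
        by (rule zero_head[OF qi _ xi[OF that]]) (use that in auto)
      moreover have "c (x, j) = 0" if "x \<notin> {q, i, j, p}" for x
        by (rule zero_head[OF ij _ lj[OF that]]) (use that in auto)
      ultimately show "c e = 0" if "e \<in> S" "e \<noteq> (p, q)" for e
        using mem'[OF that(1)] that(2) zero_A[of e] d by auto
    qed
  qed auto
qed

text \<open>
Since \<open>B\<close> is nonempty, some condition involves two arcs of \<open>A\<close>, and these are \<open>(q, j)\<close> and \<open>(i, p)\<close>, where
\<open>i = j\<close> is possible. In the chain \<open>p, q, j\<close> all further elements are placed below \<open>j\<close>, except for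
\<open>i\<close> when it differs from \<open>j\<close>, because then \<open>(i, j)\<close> is in \<open>B\<close> by C2.
\<close>

lemma zero_blocked_no_free:
  assumes "blocked_arc A B p q" and no_free: "\<And>x y. (x, y) \<in> A \<Longrightarrow> x = q \<or> y = p"
  shows "c (p, q) = 0"
proof -
  interpret blocked_arc A B p q by fact
  obtain b where "b \<in> B" using B_ne by blast
  then have "\<exists>x y x' y'. (x, y) \<in> A \<and> (x', y') \<in> A \<and> x \<noteq> x' \<and> y \<noteq> y'"
  proof (cases rule: needed)
    case (C2 i j k l)
    then have "i \<noteq> k" "j \<noteq> l" by auto
    then show ?thesis using C2 by blast
  next
    case (C4 i j k)
    then have "i \<noteq> j" "j \<noteq> k" by auto
    then show ?thesis using C4 by blast
  next
    case (C5 i j k l)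
    then have "i \<noteq> j" "j \<noteq> k" by auto
    then show ?thesis using C5 by blast
  qed
  then obtain j i where qj: "(q, j) \<in> A" and ip: "(i, p) \<in> A" and ne: "i \<noteq> q" "j \<noteq> p"
    using no_free by metis
  have d: "distinct [p, q, j]" "i \<notin> {p, q}"
    using p_ne_q irrefl[OF qj] irrefl[OF ip] ne by auto
  have tails: "x \<in> {q, i}" if "(x, y) \<in> A" for x y
    using no_free[OF that] head_unique[OF ip, of x] that by auto
  have heads: "y \<in> {j, p}" if "(x, y) \<in> A" for x y
    using no_free[OF that] tail_unique[OF qj, of y] that by auto
  have xj: "(x, j) \<notin> B" if x: "x \<notin> {q, i}" for x
  proof
    assume "(x, j) \<in> B"
    show False
      by (rule head_needed[OF \<open>(x, j) \<in> B\<close> qj]) (use tails x q_no_head in blast)+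
  qed
  have pi: "(p, i) \<notin> B \<and> c (p, i) = 0" if i: "i \<noteq> j"
  proof -
    have no_path: False if "(x, y) \<in> A" "(y, z) \<in> A" for x y z
      using heads[OF that(1)] tails[OF that(2)] i d by auto
    have pi: "(p, i) \<notin> B"
    proof
      assume "(p, i) \<in> B"
      then show False
        by (cases rule: needed) (use heads no_path i d in blast)+
    qed
    have "(q, i) \<notin> B"
    proof
      assume "(q, i) \<in> B"
      show False
        by (rule tail_needed[OF \<open>(q, i) \<in> B\<close> qj]) (use heads no_path[OF qj] i d in blast)+
    qed
    then show ?thesis using zero_unblocked[OF qj, of p i] pi i d by auto
  qed
  show ?thesis
  proof (rule semiorder_chain3[OF d(1), of "{i}"])
    fix S
    assume S: "semiorder S" "(p, q) \<in> S" "(q, j) \<in> S"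
      and mem: "\<And>x y. (x, y) \<in> S \<Longrightarrow> (x, y) \<in> {(p, q), (q, j), (p, j)} \<or>
        x = p \<and> y \<in> {i} - {p, q, j} \<or> y = j \<and> x \<notin> {i} \<union> {p, q, j}"
    have mem': "e = (p, q) \<or> e \<in> A \<or> (\<exists>x. x \<notin> {q, i, j} \<and> e = (x, j)) \<or> e = (p, i) \<and> i \<noteq> j"
      if "e \<in> S" for e
      using mem[of "fst e" "snd e"] that qj d by (cases e) auto
    show ?thesis
    proof (rule isolate_one[OF S(1) _ qj S(3,2)])
      have "e \<notin> B" if "e \<in> S" for e
        using mem'[OF that] pq_notin disj xj pi by auto
      then show "S \<inter> B = {}" by blast
      have "c (x, j) = 0" if "x \<notin> {q, i, j}" for x
        by (rule zero_head[OF qj]) (use that xj in auto)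
      then show "c e = 0" if "e \<in> S" "e \<noteq> (p, q)" for e
        using mem'[OF that(1)] that(2) zero_A[of e] pi by auto
    qed
  qed
qed

text \<open>
If \<open>c\<close> does not vanish at \<open>(p, q)\<close>, then no small semiorder isolates this arc, which means that it is
blocked; the shapes of \<open>A\<close> that admit a blocked arc are then excluded one by one.
\<close>

lemma zero_outside:
  assumes pq: "p \<noteq> q" and notA: "(p, q) \<notin> A" and notB: "(p, q) \<notin> B"
  shows "c (p, q) = 0"
proof (rule ccontr)
  assume nz: "c (p, q) \<noteq> 0"
  interpret blocked_arc A B p q
  proof
    show p: "(p, x) \<notin> A" for x using zero_tail[of p x q] pq notB nz by blast
    show q: "(x, q) \<notin> A" for x using zero_head[of x q p] pq notB nz by blast
    show "p \<noteq> q" "(p, q) \<notin> B" by fact+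
    fix i j assume ij: "(i, j) \<in> A" "i \<noteq> q" "j \<noteq> p"
    then have "distinct [i, j, p, q]" using p q pq irrefl[OF ij(1)] by auto
    then show "(i, q) \<in> B \<and> (p, j) \<in> B" using zero_unblocked[OF ij(1) _ notB] nz by blast
  qed
  show False
  proof (cases "\<exists>i j. (i, j) \<in> A \<and> i \<noteq> q \<and> j \<noteq> p")
    case True
    then obtain i j where ij: "(i, j) \<in> A" "i \<noteq> q" "j \<noteq> p" by blast
    then have "(q, i) \<in> A \<and> (j, p) \<in> A"
      using free_arc exceptional_if_cycle4 not_exceptional by blast
    then show False
      using zero_blocked_path[OF blocked_arc_axioms _ ij(1)] nz by blast
  next
    case False
    then show False using zero_blocked_no_free[OF blocked_arc_axioms] nz by blast
  qed
qed

text \<open>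
For C5 the violating semiorder of \<open>B - {b}\<close> may contain arcs outside \<open>A \<union> B\<close> anywhere, so this case
relies on \<open>zero_outside\<close>.
\<close>

lemma zero_B:
  assumes "b \<in> B"
  shows "c b = 0"
  using assms
proof (cases rule: needed)
  case (C2 i j k l)
  then show ?thesis using zero_cross by simp
next
  case (C4 i j k)
  then show ?thesis using zero_C4_critical by auto
next
  case (C5 i j k l)
  have il: "c (i, l) = 0" "(i, l) \<in> B"
    using zero_cross[OF C5(1,3)] cross[OF C5(1,3)] C5(4) by auto
  show ?thesis
  proof (cases "b = (i, l)")
    case True
    then show ?thesis using il by simp
  next
    case False
    obtain S where S: "semiorder S" "(i, j) \<in> S" "(j, k) \<in> S" "(k, l) \<in> S"
      "S \<inter> (B - {b}) \<subseteq> {(i, l)}"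
      using C5_violator[OF C5(4) _ _ _ C5(5)] C5(1-3) disj by blast
    have "card {(i, j), (j, k), (k, l)} \<le> card (S \<inter> A)"
      using S C5 by (intro card_mono) auto
    then have three: "3 \<le> card (S \<inter> A)" using C5(4) by simp
    have "b \<in> S"
    proof (rule ccontr)
      assume "b \<notin> S"
      then have "card (S \<inter> B) \<le> card {(i, l)}" using S(5) by (intro card_mono) auto
      then show False using valid[OF S(1)] three by simp
    qed
    show ?thesis
    proof (rule isolate[OF S(1) _ \<open>b \<in> S\<close>])
      have "card (S \<inter> B) \<le> card {(i, l), b}" using S(5) by (intro card_mono) auto
      also have "\<dots> \<le> 2" by (simp add: card_insert_if)
      finally show "card (S \<inter> B) < card (S \<inter> A)" using three by simp
      fix x assume x: "x \<in> S" "x \<noteq> b"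
      \<comment> \<open>The arcs of \<open>S\<close> other than \<open>b\<close> that lie in \<open>B\<close> reduce to \<open>(i, l)\<close>.\<close>
      obtain u v where uv: "x = (u, v)" by (cases x)
      have "u \<noteq> v" using S(1) x(1) uv by (auto simp: semiorder_def arcs_def)
      then show "c x = 0"
        using zero_A[of x] zero_outside[of u v] il S(5) x uv by blast
    qed
  qed
qed

lemma zero: "a \<in> arcs \<Longrightarrow> c a = 0"
  using zero_A zero_B zero_outside[of "fst a" "snd a"] by (cases a) (fastforce simp: arcs_def)

end

section \<open>Faces of the semiorder polytope\<close>

lemma inner_char_vec:
  assumes "S \<subseteq> arcs"
  shows "x \<bullet> char_vec S = (\<Sum>a\<in>S. coord x a)"
proof -
  have "x \<bullet> char_vec S = (\<Sum>i\<in>UNIV. if ends i \<in> S then x $ i else 0)"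
    by (auto simp: inner_vec_def char_vec_def intro!: sum.cong)
  also have "\<dots> = (\<Sum>i\<in>{i. ends i \<in> S}. x $ i)"
    by (simp add: sum.If_cases)
  also have "\<dots> = (\<Sum>a\<in>S. coord x a)"
    by (rule sum.reindex_bij_witness[of _ Arc ends])
      (use assms in \<open>auto simp: coord_def Arc_inverse ends_inverse\<close>)
  finally show ?thesis .
qed

lemma coord_char_vec: "a \<in> arcs \<Longrightarrow> coord (char_vec S) a = (if a \<in> S then 1 else 0)"
  by (simp add: coord_def char_vec_def Arc_inverse)

lemma inner_char_vec_char_vec:
  assumes "A \<subseteq> arcs"
  shows "char_vec S \<bullet> char_vec A = card (S \<inter> A)"
proof -
  have "char_vec S \<bullet> char_vec A = (\<Sum>a\<in>A. if a \<in> S then 1 else 0)"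
    unfolding inner_char_vec[OF assms] using assms by (intro sum.cong refl coord_char_vec) auto
  also have "\<dots> = card (S \<inter> A)"
    by (simp add: sum.If_cases Int_commute Collect_mem_eq)
  finally show ?thesis .
qed

lemma char_vec_in_polytope: "semiorder S \<Longrightarrow> char_vec S \<in> semiorder_polytope"
  unfolding semiorder_polytope_def by (intro hull_inc) auto

lemma polytope_halfspace:
  assumes "\<And>S. semiorder S \<Longrightarrow> v \<bullet> char_vec S \<le> d" and "x \<in> semiorder_polytope"
  shows "v \<bullet> x \<le> d"
proof -
  have "semiorder_polytope \<subseteq> {x. v \<bullet> x \<le> d}"
    unfolding semiorder_polytope_def
    by (rule hull_minimal) (use assms(1) in \<open>auto intro: convex_halfspace_le\<close>)
  then show ?thesis using assms(2) by blast
qed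

lemma char_vec_empty: "char_vec {} = 0"
  by (simp add: char_vec_def vec_eq_iff)

lemma axis_eq_char_vec: "axis (Arc a) 1 = char_vec {a}" if "a \<in> arcs"
  using that by (auto simp: axis_def char_vec_def vec_eq_iff ends_inverse Arc_inverse)

lemma aff_dim_semiorder_polytope:
  "aff_dim (semiorder_polytope :: (real ^ ('n::card2) arc) set) = DIM(real ^ 'n arc)"
proof -
  let ?P = "semiorder_polytope :: (real ^ 'n arc) set"
  have "0 \<in> ?P"
    using char_vec_in_polytope[OF semiorder_empty] by (simp add: char_vec_empty)
  then have "affine hull ?P = span ?P" by (intro affine_hull_span_0 hull_inc)
  moreover have "Basis \<subseteq> ?P"
  proof
    fix b :: "real ^ 'n arc" assume "b \<in> Basis"
    then obtain a where b: "b = axis a 1" by (auto simp: Basis_vec_def)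
    obtain i j where ij: "ends a = (i, j)" by (cases "ends a")
    have "ends a \<in> arcs" using ends by blast
    moreover from this have "semiorder {ends a}"
      using semiorder_singleton[of i j] unfolding ij by (simp add: arcs_def)
    ultimately show "b \<in> ?P"
      using char_vec_in_polytope axis_eq_char_vec[of "ends a"] by (simp add: b ends_inverse)
  qed
  then have "span ?P = UNIV" using span_mono span_Basis by blast
  ultimately have "affine hull ?P = UNIV" by simp
  then show ?thesis by (simp only: aff_dim_eq_full)
qed

text \<open>
A facet contained in \<open>x\<^sub>e = 0\<close> would have this hyperplane as its affine hull, but the hull does not contain
the origin, where \<open>v \<bullet> x = 0\<close>.
\<close>

lemma not_facet_if_lifted:
  fixes v :: "real ^ ('n::card2) arc"
  assumes lifted: "\<And>S. semiorder S \<Longrightarrow> v \<bullet> char_vec S + char_vec S $ e \<le> 1"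
  shows "\<not> {x \<in> semiorder_polytope. v \<bullet> x = 1} facet_of semiorder_polytope"
proof
  let ?P = "semiorder_polytope :: (real ^ 'n arc) set"
  let ?F = "{x \<in> ?P. v \<bullet> x = 1}" and ?H = "{x :: real ^ 'n arc. axis e 1 \<bullet> x = 0}"
  assume facet: "?F facet_of ?P"
  have "x $ e = 0" if "x \<in> ?F" for x
  proof -
    have "(v + axis e 1) \<bullet> x \<le> 1"
      by (rule polytope_halfspace) (use lifted that in \<open>auto simp: inner_add_left inner_axis'\<close>)
    moreover have "(- axis e 1) \<bullet> x \<le> 0"
      by (rule polytope_halfspace) (use that in \<open>auto simp: inner_axis' char_vec_def\<close>)
    ultimately show ?thesis using that by (simp add: inner_add_left inner_axis')
  qed
  then have "?F \<subseteq> ?H" by (auto simp: inner_axis')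
  then have sub: "affine hull ?F \<subseteq> ?H" by (simp add: hull_minimal affine_hyperplane)
  have "aff_dim ?F = aff_dim ?H"
    using facet aff_dim_semiorder_polytope[where 'n = 'n] aff_dim_hyperplane[of "axis e (1::real)"]
    by (simp add: facet_of_def axis_eq_0_iff)
  moreover have "affine hull ?F \<noteq> {}" using facet by (simp add: facet_of_def)
  ultimately have "affine hull ?F = ?H"
    by (intro affine_dim_equal sub) (simp_all add: affine_hyperplane)
  moreover have "affine hull ?F \<subseteq> {x. v \<bullet> x = 1}"
    by (rule hull_minimal) (auto simp: affine_hyperplane)
  moreover have "0 \<in> ?H" by simp
  ultimately have "0 \<in> {x. v \<bullet> x = 1}" by blast
  then show False by simp
qed

text \<open>
The affine hull of the face avoids the origin, so its dimension is one less than that of the linear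
span, and the hypothesis says that the span is the whole space.
\<close>

lemma facet_if_no_normal:
  fixes v :: "real ^ ('n::card2) arc"
  assumes valid: "\<And>S. semiorder S \<Longrightarrow> v \<bullet> char_vec S \<le> 1"
    and normal: "\<And>w. (\<And>S. semiorder S \<Longrightarrow> v \<bullet> char_vec S = 1 \<Longrightarrow> w \<bullet> char_vec S = 0) \<Longrightarrow> w = 0"
  shows "{x \<in> semiorder_polytope. v \<bullet> x = 1} facet_of semiorder_polytope"
proof -
  let ?P = "semiorder_polytope :: (real ^ 'n arc) set"
  let ?F = "{x \<in> ?P. v \<bullet> x = 1}"
  have face: "?F face_of ?P"
  proof -
    have "?P \<inter> {x. v \<bullet> x = 1} face_of ?P"
      by (rule face_of_Int_supporting_hyperplane_le)
        (auto simp: semiorder_polytope_def[symmetric] intro: polytope_halfspace[OF valid]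
          intro!: convex_convex_hull[of "{char_vec S |S. semiorder S}", folded semiorder_polytope_def])
    then show ?thesis by (simp add: Int_def)
  qed
  have "span ?F = UNIV"
  proof (rule ccontr)
    assume "span ?F \<noteq> UNIV"
    then obtain w where w: "w \<noteq> 0" "span ?F \<subseteq> {x. w \<bullet> x = 0}"
      using span_not_univ_subset_hyperplane by blast
    have "w \<bullet> char_vec S = 0" if "semiorder S" "v \<bullet> char_vec S = 1" for S
      using w(2) span_base[of "char_vec S" ?F] char_vec_in_polytope[OF that(1)] that(2) by auto
    then show False using normal w(1) by blast
  qed
  then have dim_F: "dim ?F = DIM(real ^ 'n arc)" by (simp only: dim_span[of ?F, symmetric] dim_UNIV)
  have zero: "0 \<notin> affine hull ?F"
  proof -
    have "affine hull ?F \<subseteq> {x. v \<bullet> x = 1}"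
      by (rule hull_minimal) (auto simp: affine_hyperplane)
    then show ?thesis by auto
  qed
  have "aff_dim (insert 0 ?F) = dim (insert 0 ?F)"
    by (rule aff_dim_zero) (simp add: hull_inc)
  moreover have "dim (insert 0 ?F) = dim ?F"
    by (simp only: dim_insert span_zero if_True)
  moreover have "aff_dim (insert 0 ?F) = aff_dim ?F + 1"
    using zero by (simp only: aff_dim_insert if_False)
  ultimately have "aff_dim ?F = int (DIM(real ^ 'n arc)) - 1"
    using dim_F by linarith
  moreover have "?F \<noteq> {}"
  proof
    assume "?F = {}"
    then have "dim ?F = 0" by (simp only: dim_empty)
    then show False using dim_F DIM_positive[where 'a = "real ^ 'n arc"] by linarith
  qed
  ultimately show ?thesis
    using face unfolding facet_of_def aff_dim_semiorder_polytope by blast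
qed

text \<open>
Let \<open>e\<close> be the arc \<open>(5, 6)\<close>. If \<open>S\<close> contains \<open>e\<close>, then for every arc \<open>(x, y)\<close> of \<open>S \<inter> A\<close> it contains \<open>(x, 6)\<close>
or \<open>(5, y)\<close>, and both are in \<open>B\<close>. As the arcs of \<open>A\<close> have distinct tails and distinct heads, this assigns
different arcs of \<open>B\<close> to different arcs of \<open>A\<close>.
\<close>

lemma exceptional_lifted:
  fixes A B :: "('n::finite \<times> 'n) set"
  assumes "exceptional A B"
  obtains e where "e \<in> arcs" "\<And>S. semiorder S \<Longrightarrow> e \<in> S \<Longrightarrow> card (S \<inter> A) \<le> card (S \<inter> B)"
proof -
  from assms obtain \<sigma> :: "nat \<Rightarrow> 'n" where card: "6 \<le> CARD('n)"
    and bij: "bij_betw \<sigma> {1..CARD('n)} UNIV"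
    and A: "A = map_prod \<sigma> \<sigma> ` A6" and B: "B = map_prod \<sigma> \<sigma> ` B6"
    unfolding exceptional_def by blast
  have inj: "\<sigma> x = \<sigma> y \<longleftrightarrow> x = y" if "x \<in> {1..6}" "y \<in> {1..6}" for x y
    using bij_betw_imp_inj_on[OF bij] that card by (auto simp: inj_on_eq_iff)
  have tail: "(x, \<sigma> 6) \<in> B \<and> (\<sigma> 5, y) \<in> B" "x \<noteq> \<sigma> 5" if "(x, y) \<in> A" for x y
    using that inj unfolding A B A6_def B6_def by auto
  have uniq: "x = x' \<longleftrightarrow> y = y'" if "(x, y) \<in> A" "(x', y') \<in> A" for x y x' y'
    using that inj unfolding A A6_def by auto
  show thesis
  proof
    show "(\<sigma> 5, \<sigma> 6) \<in> arcs" using inj[of 5 6] by (simp add: arcs_def)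
    fix S :: "('n \<times> 'n) set" assume "semiorder S" and mem: "(\<sigma> 5, \<sigma> 6) \<in> S"
    then obtain f where "S = threshold_rel f" by (blast elim: semiorderE)
    then have S: "(x, y) \<in> S \<longleftrightarrow> f x + 1 < f y" for x y
      by (simp add: threshold_rel_def)
    define g where "g = (\<lambda>(x, y). if (x, \<sigma> 6) \<in> S then (x, \<sigma> 6) else (\<sigma> 5, y))"
    have "g ` (S \<inter> A) \<subseteq> S \<inter> B"
    proof
      fix b assume "b \<in> g ` (S \<inter> A)"
      then obtain x y where xy: "(x, y) \<in> S" "(x, y) \<in> A" "b = g (x, y)" by auto
      have "(x, \<sigma> 6) \<in> S \<or> (\<sigma> 5, y) \<in> S" using xy(1) mem by (auto simp: S)
      then show "b \<in> S \<inter> B" using tail(1)[OF xy(2)] by (auto simp: xy(3) g_def)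
    qed
    moreover have "inj_on g (S \<inter> A)"
    proof (rule inj_onI)
      fix a b assume ab: "a \<in> S \<inter> A" "b \<in> S \<inter> A" "g a = g b"
      obtain x y x' y' where eq: "a = (x, y)" "b = (x', y')" by (cases a; cases b)
      have "x = x' \<or> y = y'"
        using ab(3) tail(2)[of x y] tail(2)[of x' y'] ab(1,2) unfolding eq g_def
        by (simp split: if_splits)
      then show "a = b" using uniq[of x y x' y'] ab(1,2) unfolding eq by blast
    qed
    ultimately show "card (S \<inter> A) \<le> card (S \<inter> B)"
      by (intro card_inj_on_le[of g]) auto
  qed
qed

theorem theorem12:
  fixes A B :: "('n::card2 \<times> 'n) set"
  assumes "CARD('n) \<ge> 2"
    and "A \<subseteq> arcs" and "B \<subseteq> arcs"
    and "A \<inter> B = {}" and "A \<noteq> {}" and "B \<noteq> {}"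
  shows "defines_facet (\<lambda>x. (\<Sum>a\<in>A. coord x a) - (\<Sum>b\<in>B. coord x b)) 1
           (semiorder_polytope :: (real ^ 'n arc) set)
     \<longleftrightarrow>
       \<not> exceptional A B
     \<and> all_conds A B
     \<and> (\<forall>c\<in>B. \<not> all_conds A (B - {c}))"
proof -
  let ?P = "semiorder_polytope :: (real ^ 'n arc) set"
  define v :: "real ^ 'n arc" where "v = char_vec A - char_vec B"
  have lhs: "(\<Sum>a\<in>A. coord x a) - (\<Sum>b\<in>B. coord x b) = v \<bullet> x" for x
    using assms(2,3)
    by (simp add: v_def inner_commute[of "char_vec A - char_vec B" x] inner_diff_right inner_char_vec)
  have vS: "v \<bullet> char_vec S = real (card (S \<inter> A)) - real (card (S \<inter> B))" for S
    using assms(2,3)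
    by (simp add: v_def inner_commute[of "char_vec A - char_vec B"] inner_diff_right
        inner_char_vec_char_vec)
  have coord: "char_vec S $ Arc e = (if e \<in> S then 1 else 0)" if "e \<in> arcs"
    for S :: "('n \<times> 'n) set" and e
    using coord_char_vec[OF that] by (simp add: coord_def)
  have facet_iff: "defines_facet (\<lambda>x. (\<Sum>a\<in>A. coord x a) - (\<Sum>b\<in>B. coord x b)) 1 ?P \<longleftrightarrow>
    valid_for_semiorders A B \<and> {x \<in> ?P. v \<bullet> x = 1} facet_of ?P"
  proof -
    have "(\<forall>x\<in>?P. v \<bullet> x \<le> 1) \<longleftrightarrow> (\<forall>S. semiorder S \<longrightarrow> v \<bullet> char_vec S \<le> 1)"
      using polytope_halfspace[of v 1] char_vec_in_polytope by blast
    also have "\<dots> \<longleftrightarrow> valid_for_semiorders A B"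
      unfolding valid_for_semiorders_def vS by (simp add: algebra_simps flip: of_nat_Suc)
    finally show ?thesis by (simp add: defines_facet_def lhs)
  qed
  show ?thesis
  proof (intro iffI conjI)
    assume "defines_facet (\<lambda>x. (\<Sum>a\<in>A. coord x a) - (\<Sum>b\<in>B. coord x b)) 1 ?P"
    then have valid: "valid_for_semiorders A B" and facet: "{x \<in> ?P. v \<bullet> x = 1} facet_of ?P"
      using facet_iff by auto
    show "all_conds A B" by (rule all_conds_if_valid[OF assms(2,4) valid])
    show "\<not> exceptional A B"
    proof
      assume "exceptional A B"
      then obtain e where e: "e \<in> arcs"
        "\<And>S. semiorder S \<Longrightarrow> e \<in> S \<Longrightarrow> card (S \<inter> A) \<le> card (S \<inter> B)"
        by (rule exceptional_lifted) blast
      have "v \<bullet> char_vec S + char_vec S $ Arc e \<le> 1" if "semiorder S" for S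
      proof -
        have "card (S \<inter> A) \<le> card (S \<inter> B) + 1"
          using valid that by (simp add: valid_for_semiorders_def)
        then show ?thesis using e(2)[OF that] unfolding vS coord[OF e(1)] by (cases "e \<in> S") auto
      qed
      from not_facet_if_lifted[OF this] show False using facet by contradiction
    qed
    show "\<forall>c\<in>B. \<not> all_conds A (B - {c})"
    proof (intro ballI notI)
      fix c assume c: "c \<in> B" and "all_conds A (B - {c})"
      then have valid': "valid_for_semiorders A (B - {c})"
        using valid_if_all_conds assms(2) by blast
      have "v \<bullet> char_vec S + char_vec S $ Arc c \<le> 1" if S: "semiorder S" for S
      proof -
        have "card (S \<inter> A) \<le> card (S \<inter> (B - {c})) + 1"
          using valid' S by (simp add: valid_for_semiorders_def)
        then have less: "card (S \<inter> A) \<le> card (S \<inter> B - {c}) + 1"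
          by (simp only: Int_Diff)
        have "c \<in> arcs" using c assms(3) by blast
        show ?thesis
        proof (cases "c \<in> S")
          case True
          then have "card (S \<inter> B) = card (S \<inter> B - {c}) + 1"
            using c card_Suc_Diff1[of "S \<inter> B" c] by simp
          then show ?thesis using True less unfolding vS coord[OF \<open>c \<in> arcs\<close>] by simp
        next
          case False
          then have "S \<inter> B - {c} = S \<inter> B" by simp
          then show ?thesis using False less unfolding vS coord[OF \<open>c \<in> arcs\<close>] by simp
        qed
      qed
      from not_facet_if_lifted[OF this] show False using facet by contradiction
    qed
  next
    assume "\<not> exceptional A B \<and> all_conds A B \<and> (\<forall>c\<in>B. \<not> all_conds A (B - {c}))"
    then have conds: "\<not> exceptional A B" "all_conds A B" "\<And>c. c \<in> B \<Longrightarrow> \<not> all_conds A (B - {c})"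
      by auto
    have valid: "valid_for_semiorders A B" using valid_if_all_conds assms(2) conds(2) by blast
    have "{x \<in> ?P. v \<bullet> x = 1} facet_of ?P"
    proof (rule facet_if_no_normal)
      show "v \<bullet> char_vec S \<le> 1" if "semiorder S" for S
      proof -
        have "card (S \<inter> A) \<le> card (S \<inter> B) + 1"
          using valid that by (simp add: valid_for_semiorders_def)
        then show ?thesis unfolding vS by linarith
      qed
      fix w :: "real ^ 'n arc"
      assume w: "\<And>S. semiorder S \<Longrightarrow> v \<bullet> char_vec S = 1 \<Longrightarrow> w \<bullet> char_vec S = 0"
      interpret vanishing_functional A B "coord w"
      proof
        fix S :: "('n \<times> 'n) set" assume S: "semiorder S" and tight: "card (S \<inter> A) = card (S \<inter> B) + 1"
        have "v \<bullet> char_vec S = 1" unfolding vS tight by simp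
        then have "w \<bullet> char_vec S = 0" using w S by blast
        moreover have "S \<subseteq> arcs" using S by (simp add: semiorder_def)
        ultimately show "sum (coord w) S = 0" using inner_char_vec by metis
      qed (use assms conds in auto)
      have "w $ a = 0" for a
        using zero[of "ends a"] ends[of a] by (simp add: coord_def ends_inverse)
      then show "w = 0" by (simp add: vec_eq_iff)
    qed
    then show "defines_facet (\<lambda>x. (\<Sum>a\<in>A. coord x a) - (\<Sum>b\<in>B. coord x b)) 1 ?P"
      using facet_iff valid by blast
  qed
qed

end
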